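(* Let $d \geq 1$ be an integer, let $\alpha \in (1,2)$ and let $\nu_\alpha$ be a non-degenerate symmetric $\alpha$-stable L\'evy measure on $\mathbb{R}^d$. Then, for all Borel sets $E\subset\mathbb{R}^d$ with $\mathcal{L}_d(E)<+\infty$, $$\mathcal{P}_{\mathrm{frac}}^{\mathrm{var}}(E) = \mathcal{P}_{\mathrm{frac}}(E),$$ where $$\mathcal{P}^{\mathrm{var}}_{\mathrm{frac}}(E) = \sup\left\{\int_E \mathrm{div}_\alpha(\varphi)(x) dx: \ \varphi \in \mathcal{C}^{\infty}_c(\mathbb{R}^d, \mathbb{R}^d),\ \|\varphi\|_{\infty} \leq 1 \right\},\qquad \mathcal{P}_{\mathrm{frac}}(E)=\lim_{t\to0^+}\|D^{\alpha-1}P_t^\alpha(\mathbf{1}_E)\|_{L^1(\mathbb{R}^d,dx)}.$$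
   Context: $\|\cdot\|$ and $\langle\cdot;\cdot\rangle$ are the Euclidean norm and inner product on $\mathbb{R}^d$, $\mathbb{S}^{d-1}$ is the Euclidean unit sphere, $\mathcal{L}_d$ is $d$-dimensional Lebesgue measure, and $\|\varphi\|_\infty=\sup_x\|\varphi(x)\|$. A symmetric $\alpha$-stable L\'evy measure is $\nu_\alpha(B)=\int_{\mathbb{S}^{d-1}}\int_0^{+\infty} \mathbf{1}_B(ry)\,\frac{dr}{r^{\alpha+1}}\,\sigma(dy)$, where $\sigma$ is a finite positive symmetric ($\sigma(B)=\sigma(-B)$) Borel measure on $\mathbb{S}^{d-1}$. With $\lambda_1 = -\cos(\alpha\pi/2)\frac{\Gamma(2-\alpha)}{\alpha(\alpha-1)}\sigma$, it is non-degenerate if $\inf_{y\in\mathbb{S}^{d-1}}\int_{\mathbb{S}^{d-1}}|\langle y;x\rangle|^\alpha\lambda_1(dx)>0$. Let $\mu_\alpha$ be the probability measure with $\int e^{i\langle y;\xi\rangle}\mu_\alpha(dy)=\exp(-\int_{\mathbb{S}^{d-1}}|\langle y;\xi\rangle|^\alpha\lambda_1(dy))$, $P_t^\alpha(f)(x)=\int_{\mathbb{R}^d}f(x+t^{1/\alpha}y)\mu_\alpha(dy)$, and $D^{\alpha-1}(f)(x)=\int_{\mathbb{R}^d}(f(x+u)-f(x))\,u\,\nu_\alpha(du)$, with components $D^{\alpha-1}_k$, $k\in\{1,\dots,d\}$. The fractional divergence of $\varphi=(\varphi_1,\dots,\varphi_d)\in\mathcal{C}_c^\infty(\mathbb{R}^d,\mathbb{R}^d)$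 is $\mathrm{div}_\alpha(\varphi)(x)=\sum_{k=1}^dD_k^{\alpha-1}(\varphi_k)(x)$. The limit defining $\mathcal{P}_{\mathrm{frac}}(E)$ exists in $[0,+\infty]$; both quantities may equal $+\infty$. The $L^1$ norm of an $\mathbb{R}^d$-valued function is the $L^1$ norm of its Euclidean norm. *)

theory Defs
  imports "HOL-Probability.Probability"
begin

section \<open>Symmetric stable Levy measures\<close>

definition symmetric_sphere_measure :: "(real^'n) measure \<Rightarrow> bool" where
  "symmetric_sphere_measure \<sigma> \<longleftrightarrow>
     sets \<sigma> = sets (restrict_space borel (sphere 0 1)) \<and>
     finite_measure \<sigma> \<and>
     (\<forall>B\<in>sets \<sigma>. emeasure \<sigma> (uminus ` B) = emeasure \<sigma> B)"

text \<open>The lemma \<open>emeasure_stable_levy_measure\<close> below shows that the set function given to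
  \<^const>\<open>measure_of\<close> is indeed a measure.\<close>

definition stable_levy_measure :: "real \<Rightarrow> (real^'n) measure \<Rightarrow> (real^'n) measure" where
  "stable_levy_measure \<alpha> \<sigma> = measure_of UNIV (sets borel)
     (\<lambda>B. \<integral>\<^sup>+y. (\<integral>\<^sup>+r\<in>{0<..}. indicator B (r *\<^sub>R y) * ennreal (1 / r powr (\<alpha> + 1)) \<partial>lborel) \<partial>\<sigma>)"

definition spectral_measure :: "real \<Rightarrow> (real^'n) measure \<Rightarrow> (real^'n) measure" where
  "spectral_measure \<alpha> \<sigma> =
     scale_measure (ennreal (- cos (\<alpha> * pi / 2) * (Gamma (2 - \<alpha>) / (\<alpha> * (\<alpha> - 1))))) \<sigma>"

definition nondegenerate :: "real \<Rightarrow> (real^'n) measure \<Rightarrow> bool" where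
  "nondegenerate \<alpha> \<sigma> \<longleftrightarrow>
     (INF y\<in>sphere 0 1. LINT x|spectral_measure \<alpha> \<sigma>. \<bar>y \<bullet> x\<bar> powr \<alpha>) > 0"

definition stable_law :: "real \<Rightarrow> (real^'n) measure \<Rightarrow> (real^'n) measure \<Rightarrow> bool" where
  "stable_law \<alpha> \<sigma> \<mu> \<longleftrightarrow>
     prob_space \<mu> \<and> sets \<mu> = sets borel \<and>
     (\<forall>\<xi>. (CLINT y|\<mu>. iexp (y \<bullet> \<xi>)) =
        complex_of_real (exp (- (LINT y|spectral_measure \<alpha> \<sigma>. \<bar>y \<bullet> \<xi>\<bar> powr \<alpha>))))"

section \<open>Stable semigroup, fractional gradient and fractional divergence\<close>

definition stable_semigroup ::
    "real \<Rightarrow> (real^'n) measure \<Rightarrow> real \<Rightarrow> (real^'n \<Rightarrow> real) \<Rightarrow> real^'n \<Rightarrow> real" where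
  "stable_semigroup \<alpha> \<mu> t f x = (LINT y|\<mu>. f (x + (t powr (1 / \<alpha>)) *\<^sub>R y))"

definition frac_gradient :: "(real^'n) measure \<Rightarrow> (real^'n \<Rightarrow> real) \<Rightarrow> real^'n \<Rightarrow> real^'n" where
  "frac_gradient \<nu> f x = (LINT u|\<nu>. (f (x + u) - f x) *\<^sub>R u)"

definition frac_div :: "(real^'n) measure \<Rightarrow> (real^'n \<Rightarrow> real^'n) \<Rightarrow> real^'n \<Rightarrow> real" where
  "frac_div \<nu> \<phi> x = (\<Sum>k\<in>UNIV. frac_gradient \<nu> (\<lambda>z. \<phi> z $ k) x $ k)"

section \<open>Test fields\<close>

fun C_k :: "nat \<Rightarrow> (real^'n \<Rightarrow> real^'m) \<Rightarrow> bool" where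
  "C_k 0 f \<longleftrightarrow> continuous_on UNIV f"
| "C_k (Suc k) f \<longleftrightarrow>
     (\<forall>x. f differentiable at x) \<and> (\<forall>v. C_k k (\<lambda>x. frechet_derivative f (at x) v))"

definition test_fields :: "(real^'n \<Rightarrow> real^'m) set" where
  "test_fields = {\<phi>. (\<forall>k. C_k k \<phi>) \<and> compact (closure {x. \<phi> x \<noteq> 0})}"

section \<open>Fractional perimeters\<close>

definition frac_perimeter_var :: "(real^'n) measure \<Rightarrow> (real^'n) set \<Rightarrow> ereal" where
  "frac_perimeter_var \<nu> E =
     Sup {ereal (LINT x:E|lborel. frac_div \<nu> \<phi> x) | \<phi>.
          \<phi> \<in> test_fields \<and> (SUP x. norm (\<phi> x)) \<le> 1}"

definition L1_norm :: "(real^'n \<Rightarrow> real^'n) \<Rightarrow> ereal" where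
  "L1_norm g = enn2ereal (\<integral>\<^sup>+x. ennreal (norm (g x)) \<partial>lborel)"

definition frac_perimeter ::
    "real \<Rightarrow> (real^'n) measure \<Rightarrow> (real^'n) measure \<Rightarrow> (real^'n) set \<Rightarrow> ereal" where
  "frac_perimeter \<alpha> \<nu> \<mu> E =
     Lim (at_right 0) (\<lambda>t. L1_norm (frac_gradient \<nu> (stable_semigroup \<alpha> \<mu> t (indicator E))))"

section \<open>Well-definedness of the Levy measure\<close>

lemma emeasure_stable_levy_measure:
  fixes \<sigma> :: "(real^'n) measure"
  assumes \<sigma>: "symmetric_sphere_measure \<sigma>" and B: "B \<in> sets borel"
  shows "emeasure (stable_levy_measure \<alpha> \<sigma>) B =
    (\<integral>\<^sup>+y. (\<integral>\<^sup>+r\<in>{0<..}. indicator B (r *\<^sub>R y) * ennreal (1 / r powr (\<alpha> + 1)) \<partial>lborel) \<partial>\<sigma>)"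
proof -
  let ?g = "\<lambda>(B::(real^'n) set) y r. indicator B (r *\<^sub>R y) * ennreal (1 / r powr (\<alpha> + 1)) * indicator {0<..} r"
  have id [measurable]: "(\<lambda>x. x) \<in> borel_measurable \<sigma>"
  proof -
    have "(\<lambda>x. x) \<in> borel_measurable (restrict_space borel (sphere (0::real^'n) 1))"
      by (intro measurable_restrict_space1) simp
    moreover have "sets \<sigma> = sets (restrict_space borel (sphere 0 1))"
      using \<sigma> by (simp add: symmetric_sphere_measure_def)
    ultimately show ?thesis by (simp cong: measurable_cong_sets)
  qed
  have meas2: "case_prod (?g C) \<in> borel_measurable (\<sigma> \<Otimes>\<^sub>M lborel)" if [measurable]: "C \<in> sets borel" for C
    by measurable
  have meas1: "(\<lambda>r. ?g C y r) \<in> borel_measurable lborel" if [measurable]: "C \<in> sets borel" for C y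
    by measurable
  have meas: "(\<lambda>y. \<integral>\<^sup>+r. ?g C y r \<partial>lborel) \<in> borel_measurable \<sigma>" if "C \<in> sets borel" for C
    using lborel.borel_measurable_nn_integral[OF meas2[OF that]] by simp
  have ca: "countably_additive (sets borel) (\<lambda>C. \<integral>\<^sup>+y. (\<integral>\<^sup>+r. ?g C y r \<partial>lborel) \<partial>\<sigma>)"
  proof (rule countably_additiveI)
    fix A :: "nat \<Rightarrow> (real^'n) set"
    assume A: "range A \<subseteq> sets borel" "disjoint_family A"
    have A': "A i \<in> sets borel" for i using A(1) by auto
    have "(\<Sum>i. \<integral>\<^sup>+y. (\<integral>\<^sup>+r. ?g (A i) y r \<partial>lborel) \<partial>\<sigma>)
        = (\<integral>\<^sup>+y. (\<Sum>i. \<integral>\<^sup>+r. ?g (A i) y r \<partial>lborel) \<partial>\<sigma>)"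
      by (rule nn_integral_suminf[symmetric]) (rule meas[OF A'])
    also have "\<dots> = (\<integral>\<^sup>+y. (\<integral>\<^sup>+r. (\<Sum>i. ?g (A i) y r) \<partial>lborel) \<partial>\<sigma>)"
      by (intro nn_integral_cong nn_integral_suminf[symmetric] meas1[OF A'])
    also have "\<dots> = (\<integral>\<^sup>+y. (\<integral>\<^sup>+r. ?g (\<Union>i. A i) y r \<partial>lborel) \<partial>\<sigma>)"
      by (simp add: ennreal_suminf_multc suminf_indicator[OF A(2)])
    finally show "(\<Sum>i. \<integral>\<^sup>+y. (\<integral>\<^sup>+r. ?g (A i) y r \<partial>lborel) \<partial>\<sigma>)
        = (\<integral>\<^sup>+y. (\<integral>\<^sup>+r. ?g (\<Union>i. A i) y r \<partial>lborel) \<partial>\<sigma>)" .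
  qed
  have sa: "sigma_algebra UNIV (sets (borel :: (real^'n) measure))"
    using sets.sigma_algebra_axioms[of "borel :: (real^'n) measure"] by simp
  show ?thesis
    unfolding stable_levy_measure_def
    by (rule emeasure_measure_of_sigma[OF sa _ ca B]) (simp add: positive_def)
qed

end

theory Submission
  imports Defs
begin

text \<open>Write \<open>P\<^sub>t\<close> for the stable semigroup and \<open>P'\<^sub>t\<close> for its adjoint, the average of the
  translates \<open>x - t powr (1 / \<alpha>) y\<close> against \<open>\<mu>\<close>. By nondegeneracy the characteristic function of \<open>\<mu>\<close>
  decays so fast that \<open>\<mu>(A - u) \<le> \<mu>(A) + L |u| vol(A)\<close>; hence \<open>P\<^sub>t 1\<^sub>E\<close> is Lipschitz and its
  fractional gradient is an honest continuous bounded field. Symmetry of \<open>\<nu>\<close> then gives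
  \<open>- \<integral> \<phi> \<cdot> D (P\<^sub>t 1\<^sub>E) = \<integral> P\<^sub>t 1\<^sub>E div \<phi> = \<integral>\<^sub>E P'\<^sub>t (div \<phi>) = \<integral>\<^sub>E div (P'\<^sub>t \<phi>)\<close> for test fields \<open>\<phi>\<close>.
  Since \<open>P'\<^sub>t \<phi>\<close> is smooth, bounded by one and, after a cutoff, a test field, the supremum over \<open>\<phi>\<close> of
  the left-hand side, which is the \<open>L\<^sup>1\<close> norm of the gradient, is at most the variational perimeter
  for every \<open>t\<close>. Conversely \<open>\<integral>\<^sub>E P'\<^sub>t (div \<phi>)\<close> tends to \<open>\<integral>\<^sub>E div \<phi>\<close> as \<open>t\<close> tends to \<open>0\<close>.\<close>

text \<open>A Bochner integral that diverges has the default value 0, so each gradient and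
  divergence must be shown to converge before it can be used. Convergence comes from increments
  bounded by a multiple of \<open>min 1 (norm u)\<close>: times \<open>norm u\<close>, this is
  integrable against \<open>\<nu>\<close> exactly because \<open>\<alpha>\<close> lies strictly
  between 1 and 2. The constant L is the bound that Fourier inversion would give for the gradient of
  a density of \<open>\<mu>\<close>. The law is convolved with a Gaussian, for which inversion is an
  explicit Fubini computation and the bound is independent of the width; letting the width tend to 0
  gives the estimate for continuous functions, then open sets, then Borel sets. The field
  \<open>P'\<^sub>t \<phi>\<close> need not have bounded support. Removing its cutoff is a limit
  inside two integrals, over \<open>\<nu>\<close> and over E, so the cutoffs must share one
  Lipschitz constant for all radii. The limit at 0 exists because the bound from above holds at
  every positive time and the bound from below holds in the limit; this also covers an infinite
  perimeter.\<close>

section \<open>Continuously differentiable functions\<close>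

text \<open>\<open>C_k\<close> is typed for maps between Cartesian powers of the reals. Cutoffs are
  scalar, so the same recursion is needed between arbitrary normed spaces.\<close>

fun cont_diff :: "nat \<Rightarrow> ('a::real_normed_vector \<Rightarrow> 'b::real_normed_vector) \<Rightarrow> bool" where
  "cont_diff 0 f \<longleftrightarrow> continuous_on UNIV f"
| "cont_diff (Suc k) f \<longleftrightarrow>
     (\<forall>x. f differentiable at x) \<and> (\<forall>v. cont_diff k (\<lambda>x. frechet_derivative f (at x) v))"

lemma C_k_iff_cont_diff: "C_k k f \<longleftrightarrow> cont_diff k f"
  by (induction k arbitrary: f) auto

lemma cont_diff_SucI:
  assumes "\<And>x. (f has_derivative f' x) (at x)" "\<And>v. cont_diff k (\<lambda>x. f' x v)"
  shows "cont_diff (Suc k) f"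
proof -
  have "frechet_derivative f (at x) = f' x" for x
    using frechet_derivative_at[OF assms(1)] by simp
  with assms show ?thesis by (auto simp: differentiable_def)
qed

lemma cont_diff_Suc_has_derivative:
  "cont_diff (Suc k) f \<Longrightarrow> (f has_derivative frechet_derivative f (at x)) (at x)"
  by (simp add: frechet_derivative_works)

lemma cont_diff_Suc_imp: "cont_diff (Suc k) f \<Longrightarrow> cont_diff k f"
proof (induction k arbitrary: f)
  case 0
  then show ?case
    by (auto intro!: continuous_at_imp_continuous_on differentiable_imp_continuous_within)
next
  case (Suc k)
  have "cont_diff k (\<lambda>x. frechet_derivative f (at x) v)" for v
    using Suc.IH Suc.prems by fastforce
  then show ?case using Suc.prems by auto
qed

lemma cont_diff_imp_continuous: "cont_diff k f \<Longrightarrow> continuous_on UNIV f"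
  by (induction k) (auto dest: cont_diff_Suc_imp simp del: cont_diff.simps(2))

lemma cont_diff_const: "cont_diff k (\<lambda>x. c)"
proof (induction k arbitrary: c)
  case (Suc k)
  show ?case
    by (rule cont_diff_SucI[where f' = "\<lambda>x v. 0"]) (auto intro: Suc)
qed simp

lemma cont_diff_bounded_linear:
  assumes "bounded_linear f" shows "cont_diff k f"
proof (cases k)
  case 0
  with assms show ?thesis by (simp add: linear_continuous_on)
next
  case (Suc l)
  show ?thesis unfolding Suc
    by (rule cont_diff_SucI[where f' = "\<lambda>x. f"])
       (auto intro: cont_diff_const bounded_linear_imp_has_derivative assms)
qed

lemma cont_diff_add:
  "cont_diff k f \<Longrightarrow> cont_diff k g \<Longrightarrow> cont_diff k (\<lambda>x. f x + g x)"
proof (induction k arbitrary: f g)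
  case 0 then show ?case by (simp add: continuous_on_add)
next
  case (Suc k)
  show ?case
    by (rule cont_diff_SucI[OF has_derivative_add[OF cont_diff_Suc_has_derivative[OF Suc.prems(1)]
          cont_diff_Suc_has_derivative[OF Suc.prems(2)]]])
       (use Suc in auto)
qed

lemma cont_diff_sum:
  "(\<And>i. i \<in> I \<Longrightarrow> cont_diff k (f i)) \<Longrightarrow> cont_diff k (\<lambda>x. \<Sum>i\<in>I. f i x)"
  by (induction I rule: infinite_finite_induct) (auto intro: cont_diff_const cont_diff_add)

text \<open>The derivative is a sum of two terms with one factor differentiated in each; the other
  factor is lowered from class \<open>Suc k\<close> to class \<open>k\<close> by
  \<open>cont_diff_Suc_imp\<close>.\<close>

lemma cont_diff_bilinear:
  assumes "bounded_bilinear p"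
  shows "cont_diff k f \<Longrightarrow> cont_diff k g \<Longrightarrow> cont_diff k (\<lambda>x. p (f x) (g x))"
proof (induction k arbitrary: f g)
  case 0 then show ?case by (simp add: bounded_bilinear.continuous_on[OF assms])
next
  case (Suc k)
  note d = Suc.prems[THEN cont_diff_Suc_has_derivative]
  show ?case
    by (rule cont_diff_SucI[OF bounded_bilinear.FDERIV[OF assms d]])
       (use Suc Suc.prems[THEN cont_diff_Suc_imp] in \<open>auto intro!: cont_diff_add\<close>)
qed

lemma cont_diff_real_polynomial_function:
  "real_polynomial_function p \<Longrightarrow> cont_diff k p"
  by (induction rule: real_polynomial_function.induct)
     (auto intro: cont_diff_bounded_linear cont_diff_const cont_diff_add
         cont_diff_bilinear[OF bounded_bilinear_mult])

text \<open>The Weierstrass approximants of the extremal field in \<open>L1_cutoff_le\<close> are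
  polynomial; this makes their cutoffs test functions.\<close>

lemma cont_diff_polynomial_function:
  fixes p :: "'a::real_normed_vector \<Rightarrow> real^'m"
  assumes "polynomial_function p" shows "cont_diff k p"
proof -
  have "cont_diff k (\<lambda>x. p x $ i)" for i
    using assms bounded_linear_vec_nth[of i]
    by (auto simp: polynomial_function_def comp_def intro!: cont_diff_real_polynomial_function)
  then have "cont_diff k (\<lambda>x. \<Sum>i\<in>UNIV. (p x $ i) *\<^sub>R (axis i 1 :: real^'m))"
    by (auto intro!: cont_diff_sum cont_diff_const cont_diff_bilinear[OF bounded_bilinear_scaleR])
  moreover have "(\<lambda>x. \<Sum>i\<in>UNIV. (p x $ i) *\<^sub>R (axis i 1 :: real^'m)) = p"
    by (simp add: fun_eq_iff vec_eq_iff axis_def if_distrib cong: if_cong)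
  ultimately show ?thesis by simp
qed

section \<open>Smooth cutoffs\<close>

text \<open>For \<open>k = 0\<close> this is the classical flat function exp (-1/s). The powers of
  \<open>inverse s\<close> make the family closed under differentiation up to linear combinations,
  so that smoothness becomes a single induction.\<close>

definition flat_fun :: "nat \<Rightarrow> real \<Rightarrow> real" where
  "flat_fun k s = (if s \<le> 0 then 0 else inverse s ^ k * exp (- inverse s))"

lemma flat_fun_tendsto: "(flat_fun k \<longlongrightarrow> 0) (at_right 0)"
proof -
  have "((\<lambda>s. inverse s ^ k / exp (inverse s)) \<longlongrightarrow> 0) (at_right (0::real))"
    by (rule filterlim_compose[OF tendsto_power_div_exp_0 filterlim_inverse_at_top_right])
  then show ?thesis
    by (rule Lim_transform_eventually)
       (auto simp: eventually_at_filter flat_fun_def exp_minus divide_inverse)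
qed

lemma DERIV_flat_fun:
  "(flat_fun k has_field_derivative flat_fun (k + 2) s - real k * flat_fun (k + 1) s) (at s)"
proof -
  consider "s > 0" | "s < 0" | "s = 0" by linarith
  then show ?thesis
  proof cases
    case 1
    have "((\<lambda>s. inverse s ^ k * exp (- inverse s)) has_field_derivative
        flat_fun (k + 2) s - real k * flat_fun (k + 1) s) (at s)"
    proof (cases k)
      case 0
      with 1 show ?thesis
        by (auto intro!: derivative_eq_intros simp: flat_fun_def power2_eq_square field_simps)
    next
      case (Suc l)
      have i: "(inverse has_field_derivative - (inverse s * inverse s)) (at s)"
        using 1 DERIV_inverse'[OF DERIV_ident, of s UNIV] by simp
      have "((\<lambda>s. inverse s ^ Suc l * exp (- inverse s)) has_field_derivative
          (1 + real l) * (- (inverse s * inverse s) * inverse s ^ l) * exp (- inverse s)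
            + exp (- inverse s) * - (- (inverse s * inverse s)) * inverse s ^ Suc l) (at s)"
        by (intro DERIV_mult DERIV_power_Suc DERIV_fun_exp DERIV_minus i)
      with 1 Suc show ?thesis
        by (simp add: flat_fun_def algebra_simps)
    qed
    then show ?thesis
      by (rule DERIV_cong_ev[THEN iffD1, rotated -1])
         (use 1 in \<open>auto simp: flat_fun_def intro!: eventually_mono[OF eventually_nhds_in_open[of "{0<..}"]]\<close>)
  next
    case 2
    have "((\<lambda>s. 0) has_field_derivative
        flat_fun (k + 2) s - real k * flat_fun (k + 1) s) (at s)"
      using 2 by (simp add: flat_fun_def)
    then show ?thesis
      by (rule DERIV_cong_ev[THEN iffD1, rotated -1])
         (use 2 in \<open>auto simp: flat_fun_def intro!: eventually_mono[OF eventually_nhds_in_open[of "{..<0}"]]\<close>)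
  next
    case 3
    \<comment> \<open>For positive h the difference quotient at 0 is
      \<open>flat_fun (Suc k) h\<close>, which tends to 0; for negative h it is 0.\<close>
    have "((\<lambda>h. (flat_fun k h - flat_fun k 0) / h) \<longlongrightarrow> 0) (at_right 0)"
      by (rule Lim_transform_eventually[OF flat_fun_tendsto[of "Suc k"]])
         (auto simp: eventually_at_filter flat_fun_def divide_simps)
    moreover have "((\<lambda>h. (flat_fun k h - flat_fun k 0) / h) \<longlongrightarrow> 0) (at_left 0)"
      by (rule tendsto_eventually) (auto simp: eventually_at_filter flat_fun_def)
    ultimately show ?thesis
      unfolding 3 by (auto simp: DERIV_def flat_fun_def intro: filterlim_split_at)
  qed
qed

text \<open>Differentiation sends the index \<open>k\<close> to \<open>k + 1\<close> and
  \<open>k + 2\<close>, so the induction on the order \<open>n\<close> leaves \<open>k\<close> free.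
  The squared norm inside is smooth at the origin, unlike the norm.\<close>

lemma cont_diff_flat_fun_norm:
  fixes c :: real
  shows "cont_diff n (\<lambda>x::'a::real_inner. flat_fun k (1 - c * (x \<bullet> x)))"
proof (induction n arbitrary: k)
  case 0
  have "continuous_on UNIV (flat_fun k)"
    by (intro continuous_at_imp_continuous_on) (auto intro: DERIV_isCont DERIV_flat_fun)
  then have "continuous_on UNIV (flat_fun k \<circ> (\<lambda>x::'a. 1 - c * (x \<bullet> x)))"
    by (intro continuous_on_compose continuous_intros) (auto intro: continuous_on_subset)
  then show ?case by (simp add: comp_def)
next
  case (Suc n)
  let ?f' = "\<lambda>s. flat_fun (k + 2) s - real k * flat_fun (k + 1) s"
  let ?q = "\<lambda>x::'a. 1 - c * (x \<bullet> x)"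
  have d: "((\<lambda>x. flat_fun k (?q x)) has_derivative (\<lambda>v. ?f' (?q x) * (- 2 * c * (x \<bullet> v)))) (at x)" for x
  proof -
    have "(?q has_derivative (\<lambda>v. - 2 * c * (x \<bullet> v))) (at x)"
      by (auto intro!: derivative_eq_intros simp: inner_commute algebra_simps)
    from has_derivative_compose[OF this DERIV_flat_fun[unfolded has_field_derivative_def]]
    show ?thesis .
  qed
  have "cont_diff n (\<lambda>x. ?f' (?q x))"
  proof -
    have "cont_diff n (\<lambda>x. flat_fun (k + 2) (?q x) + (- real k) * flat_fun (k + 1) (?q x))"
      by (intro cont_diff_add cont_diff_bilinear[OF bounded_bilinear_mult] cont_diff_const Suc)
    then show ?thesis by simp
  qed
  moreover have "cont_diff n (\<lambda>x. - 2 * c * (x \<bullet> v))" for v :: 'a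
    by (intro cont_diff_bounded_linear bounded_linear_mult_right[THEN bounded_linear_compose] bounded_linear_inner_left)
  ultimately show ?case
    by (intro cont_diff_SucI[OF d]) (rule cont_diff_bilinear[OF bounded_bilinear_mult])
qed

text \<open>The standard bump exp (1 - 1 / (1 - |x|^2 / R^2)); the factor \<open>exp 1\<close>
  normalises its value at the origin to 1.\<close>

definition cutoff :: "real \<Rightarrow> 'a::real_inner \<Rightarrow> real" where
  "cutoff R x = exp 1 * flat_fun 0 (1 - inverse (R\<^sup>2) * (x \<bullet> x))"

lemma cont_diff_cutoff: "cont_diff k (cutoff R)"
  unfolding cutoff_def[abs_def]
  by (intro cont_diff_bilinear[OF bounded_bilinear_mult] cont_diff_const cont_diff_flat_fun_norm)

lemma cutoff_nonneg: "0 \<le> cutoff R x"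
  by (simp add: cutoff_def flat_fun_def)

lemma cutoff_le_1: "cutoff R x \<le> 1"
proof -
  let ?s = "1 - inverse (R\<^sup>2) * (x \<bullet> x)"
  have "?s \<le> 1" by simp
  then have "?s > 0 \<Longrightarrow> inverse ?s \<ge> 1" by (metis one_le_inverse)
  then have "?s > 0 \<Longrightarrow> exp 1 * exp (- inverse ?s) \<le> 1"
    by (simp add: exp_add[symmetric])
  then show ?thesis
    by (auto simp: cutoff_def flat_fun_def)
qed

lemma cutoff_eq_0: "0 < R \<Longrightarrow> R < norm x \<Longrightarrow> cutoff R x = 0"
proof -
  assume "0 < R" "R < norm x"
  then have "R\<^sup>2 \<le> x \<bullet> x" by (metis less_imp_le power2_norm_eq_inner power_mono)
  then show "cutoff R x = 0" using \<open>0 < R\<close>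
    by (simp add: cutoff_def flat_fun_def field_simps)
qed

text \<open>All cutoffs are dilations of one profile. This yields both the pointwise convergence to
  1 and a Lipschitz constant common to all radii at least 1.\<close>

lemma cutoff_scale: "0 < R \<Longrightarrow> cutoff R x = cutoff 1 (x /\<^sub>R R)"
  by (simp add: cutoff_def power2_eq_square mult.assoc)

lemma cutoff_tendsto: "(\<lambda>n. cutoff (real (Suc n)) x) \<longlonglongrightarrow> 1"
proof -
  have "continuous_on UNIV (cutoff 1 :: 'a \<Rightarrow> real)"
    by (rule cont_diff_imp_continuous[OF cont_diff_cutoff])
  moreover have "(\<lambda>n. x /\<^sub>R real (Suc n)) \<longlonglongrightarrow> 0 *\<^sub>R x"
    by (intro tendsto_scaleR tendsto_const LIMSEQ_inverse_real_of_nat)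
  ultimately have "(\<lambda>n. cutoff 1 (x /\<^sub>R real (Suc n))) \<longlonglongrightarrow> cutoff 1 (0::'a)"
    by (intro continuous_on_tendsto_compose[where f="cutoff 1"]) auto
  moreover have "cutoff 1 (0::'a) = 1"
    by (simp add: cutoff_def flat_fun_def exp_minus)
  ultimately show ?thesis by (subst cutoff_scale) auto
qed

section \<open>Bounded Lipschitz functions\<close>

text \<open>One constant controls both large and small increments. The bound is shaped so that
  multiplying it by \<open>norm u\<close> gives the weight whose \<open>\<nu>\<close>-integral is
  finite.\<close>

definition bdd_lip :: "real \<Rightarrow> ('a::real_normed_vector \<Rightarrow> 'b::real_normed_vector) \<Rightarrow> bool" where
  "bdd_lip M f \<longleftrightarrow> (\<forall>x u. norm (f (x + u) - f x) \<le> M * min 1 (norm u))"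

definition bdd_supp :: "('a::real_normed_vector \<Rightarrow> 'b::real_normed_vector) \<Rightarrow> bool" where
  "bdd_supp f \<longleftrightarrow> (\<exists>R. \<forall>x. R < norm x \<longrightarrow> f x = 0)"

lemma bdd_lipD: "bdd_lip M f \<Longrightarrow> norm (f (x + u) - f x) \<le> M * min 1 (norm u)"
  by (simp add: bdd_lip_def)

lemma bdd_lipI:
  fixes f :: "'a::real_normed_vector \<Rightarrow> 'b::real_normed_vector"
  assumes "\<And>x. norm (f x) \<le> A" "\<And>x u. norm (f (x + u) - f x) \<le> B * norm u" "2 * A \<le> M" "B \<le> M"
  shows "bdd_lip M f"
  unfolding bdd_lip_def
proof safe
  fix x u :: 'a
  have "norm (f (x + u) - f x) \<le> M"
    using norm_triangle_ineq4[of "f (x + u)" "f x"] assms(1)[of x] assms(1)[of "x + u"] assms(3)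
    by linarith
  moreover have "norm (f (x + u) - f x) \<le> M * norm u"
    using assms(2)[of x u] mult_right_mono[OF assms(4), of "norm u"] by auto
  ultimately show "norm (f (x + u) - f x) \<le> M * min 1 (norm u)"
    by (auto simp: min_def)
qed

lemma bdd_lip_nonneg:
  fixes f :: "'a::euclidean_space \<Rightarrow> 'b::real_normed_vector"
  assumes "bdd_lip M f" shows "0 \<le> M"
proof -
  obtain b :: 'a where "b \<in> Basis" using nonempty_Basis by blast
  then have "norm (f (0 + b) - f 0) \<le> M" using bdd_lipD[OF assms, of 0 b] by simp
  then show ?thesis using norm_ge_zero order_trans by blast
qed

lemma bdd_lip_continuous:
  fixes f :: "'a::euclidean_space \<Rightarrow> 'b::real_normed_vector"
  assumes "bdd_lip M f" shows "continuous_on UNIV f"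
proof -
  have "dist (f x) (f y) \<le> M * dist x y" for x y
  proof -
    have "norm (f (y + (x - y)) - f y) \<le> M * norm (x - y)"
      by (rule order_trans[OF bdd_lipD[OF assms] mult_left_mono[OF _ bdd_lip_nonneg[OF assms]]]) simp
    then show ?thesis by (simp add: dist_norm)
  qed
  then have "M-lipschitz_on UNIV f"
    by (intro lipschitz_onI bdd_lip_nonneg[OF assms]) auto
  then show ?thesis by (rule lipschitz_on_continuous_on)
qed

lemma bdd_lip_borel_measurable:
  fixes f :: "'a::euclidean_space \<Rightarrow> 'b::real_normed_vector"
  shows "bdd_lip M f \<Longrightarrow> f \<in> borel_measurable borel"
  by (intro borel_measurable_continuous_onI bdd_lip_continuous)

lemma bdd_supp_bounded:
  fixes f :: "'a::euclidean_space \<Rightarrow> 'b::real_normed_vector"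
  assumes "bdd_supp f" "continuous_on UNIV f"
  obtains A where "\<And>x. norm (f x) \<le> A"
proof -
  obtain R where R: "\<And>x. R < norm x \<Longrightarrow> f x = 0" using assms(1) by (auto simp: bdd_supp_def)
  have "compact (f ` cball 0 R)"
    by (intro compact_continuous_image continuous_on_subset[OF assms(2)]) auto
  then obtain A where A: "\<And>x. x \<in> cball 0 R \<Longrightarrow> norm (f x) \<le> A"
    by (meson bounded_iff compact_imp_bounded imageI)
  have "norm (f x) \<le> max A 0" for x
    using A[of x] R[of x] by (cases "norm x \<le> R") auto
  then show thesis using that by blast
qed

lemma bdd_supp_frechet_derivative:
  assumes "bdd_supp f" "\<And>x. f differentiable at x"
  shows "bdd_supp (\<lambda>x. frechet_derivative f (at x) v)"
proof -
  obtain R where R: "\<And>x. R < norm x \<Longrightarrow> f x = 0" using assms(1) by (auto simp: bdd_supp_def)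
  have "frechet_derivative f (at x) v = 0" if "R < norm x" for x
  proof -
    have "open {x :: 'a. R < norm x}" by (intro open_Collect_less continuous_intros)
    then have "(f has_derivative (\<lambda>v. 0)) (at x)"
      using that by (intro has_derivative_transform_within_open[of "\<lambda>x. 0" "\<lambda>v. 0" x UNIV "{x. R < norm x}" f])
        (auto simp: R)
    then show ?thesis by (metis frechet_derivative_at)
  qed
  then show ?thesis by (auto simp: bdd_supp_def)
qed

text \<open>\<open>cont_diff\<close> speaks of one direction at a time; this turns bounds in the
  finitely many basis directions into a bound on the operator norm.\<close>

lemma linear_norm_le_sum_Basis:
  fixes L :: "'a::euclidean_space \<Rightarrow> 'b::real_normed_vector"
  assumes "bounded_linear L"
  shows "norm (L v) \<le> (\<Sum>b\<in>Basis. norm (L b)) * norm v"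
proof -
  interpret L: bounded_linear L by fact
  have "L v = (\<Sum>b\<in>Basis. (v \<bullet> b) *\<^sub>R L b)"
    by (subst euclidean_representation[symmetric, of v]) (simp add: L.sum L.scaleR)
  also have "norm \<dots> \<le> (\<Sum>b\<in>Basis. norm v * norm (L b))"
    by (rule norm_sum[THEN order_trans]) (auto intro!: sum_mono mult_right_mono Basis_le_norm)
  finally show ?thesis by (simp add: sum_distrib_left mult.commute sum_distrib_right)
qed

text \<open>The partial derivatives are continuous with bounded support, hence bounded, and the mean
  value inequality makes the sum of their bounds a Lipschitz constant.\<close>

lemma bdd_supp_cont_diff_bdd_lip:
  fixes f :: "'a::euclidean_space \<Rightarrow> 'b::real_normed_vector"
  assumes "bdd_supp f" "cont_diff (Suc 0) f"
  obtains M where "bdd_lip M f"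
proof -
  obtain A where A: "\<And>x. norm (f x) \<le> A"
    using bdd_supp_bounded[OF assms(1) cont_diff_imp_continuous[OF assms(2)]] by blast
  have "\<exists>B. \<forall>x. norm (frechet_derivative f (at x) b) \<le> B" for b
  proof -
    have "bdd_supp (\<lambda>x. frechet_derivative f (at x) b)"
      using assms by (intro bdd_supp_frechet_derivative) auto
    moreover have "continuous_on UNIV (\<lambda>x. frechet_derivative f (at x) b)"
      using assms by simp
    ultimately show ?thesis using bdd_supp_bounded by metis
  qed
  then obtain B where B: "\<And>b x. norm (frechet_derivative f (at x) b) \<le> B b" by metis
  have d: "(f has_derivative frechet_derivative f (at x)) (at x)" for x
    by (rule cont_diff_Suc_has_derivative[OF assms(2)])
  have "norm (f (x + u) - f x) \<le> (\<Sum>b\<in>Basis. B b) * norm u" for x u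
  proof -
    have "norm (f (x + u) - f x) \<le> (\<Sum>b\<in>Basis. B b) * norm ((x + u) - x)"
    proof (rule differentiable_bound[where S = UNIV and f' = "\<lambda>x. frechet_derivative f (at x)"])
      show "onorm (frechet_derivative f (at y)) \<le> (\<Sum>b\<in>Basis. B b)" for y
      proof (rule onorm_le)
        fix v
        have "norm (frechet_derivative f (at y) v) \<le> (\<Sum>b\<in>Basis. norm (frechet_derivative f (at y) b)) * norm v"
          by (rule linear_norm_le_sum_Basis[OF has_derivative_bounded_linear[OF d]])
        also have "\<dots> \<le> (\<Sum>b\<in>Basis. B b) * norm v"
          by (intro mult_right_mono sum_mono B) auto
        finally show "norm (frechet_derivative f (at y) v) \<le> (\<Sum>b\<in>Basis. B b) * norm v" .
      qed
    qed (use d in auto)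
    then show ?thesis by simp
  qed
  then have "bdd_lip (max (2 * A) (\<Sum>b\<in>Basis. B b)) f"
    by (intro bdd_lipI[OF A]) auto
  then show thesis by (rule that)
qed

lemma bdd_lip_mult:
  fixes f :: "'a::real_normed_vector \<Rightarrow> real" and g :: "'a \<Rightarrow> 'b::real_normed_vector"
  assumes "bdd_lip M f" "bdd_lip N g" "\<And>x. \<bar>f x\<bar> \<le> 1" "\<And>x. norm (g x) \<le> 1"
  shows "bdd_lip (M + N) (\<lambda>x. f x *\<^sub>R g x)"
  unfolding bdd_lip_def
proof safe
  fix x u
  have "f (x + u) *\<^sub>R g (x + u) - f x *\<^sub>R g x = (f (x + u) - f x) *\<^sub>R g (x + u) + f x *\<^sub>R (g (x + u) - g x)"
    by (simp add: algebra_simps)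
  also have "norm \<dots> \<le> \<bar>f (x + u) - f x\<bar> * norm (g (x + u)) + \<bar>f x\<bar> * norm (g (x + u) - g x)"
    by (rule norm_triangle_le) simp
  also have "\<dots> \<le> \<bar>f (x + u) - f x\<bar> * 1 + 1 * norm (g (x + u) - g x)"
    by (intro add_mono mult_mono assms) auto
  also have "\<dots> \<le> (M + N) * min 1 (norm u)"
    using bdd_lipD[OF assms(1), of x u] bdd_lipD[OF assms(2), of x u] by (simp add: algebra_simps)
  finally show "norm (f (x + u) *\<^sub>R g (x + u) - f x *\<^sub>R g x) \<le> (M + N) * min 1 (norm u)" .
qed

text \<open>Dilation by a factor \<open>R\<close> of at least 1 only shrinks increments.
  Independence of \<open>R\<close> gives the dominating function when the radius tends to
  infinity.\<close>

lemma bdd_lip_cutoff: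
  obtains M where "\<And>R. 1 \<le> R \<Longrightarrow> bdd_lip M (cutoff R :: 'a::euclidean_space \<Rightarrow> real)"
proof -
  have "bdd_supp (cutoff 1 :: 'a \<Rightarrow> real)"
    unfolding bdd_supp_def by (intro exI[of _ 1]) (auto intro: cutoff_eq_0)
  then obtain M where M: "bdd_lip M (cutoff 1 :: 'a \<Rightarrow> real)"
    using bdd_supp_cont_diff_bdd_lip cont_diff_cutoff by blast
  have "bdd_lip M (cutoff R :: 'a \<Rightarrow> real)" if "1 \<le> R" for R
    unfolding bdd_lip_def
  proof safe
    fix x u :: 'a
    have "norm (cutoff 1 (x /\<^sub>R R + u /\<^sub>R R) - cutoff 1 (x /\<^sub>R R)) \<le> M * min 1 (norm (u /\<^sub>R R))"
      by (rule bdd_lipD[OF M])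
    also have "norm (u /\<^sub>R R) \<le> norm u"
      using that by (simp add: mult_left_le_one_le inverse_le_1_iff)
    then have "M * min 1 (norm (u /\<^sub>R R)) \<le> M * min 1 (norm u)"
      by (intro mult_left_mono bdd_lip_nonneg[OF M]) auto
    finally show "norm (cutoff R (x + u) - cutoff R x) \<le> M * min 1 (norm u)"
      using that by (simp add: cutoff_scale[of R] scaleR_add_right)
  qed
  then show thesis by (rule that)
qed

section \<open>Test functions\<close>

definition test_fn :: "('a::real_normed_vector \<Rightarrow> 'b::real_normed_vector) \<Rightarrow> bool" where
  "test_fn f \<longleftrightarrow> (\<forall>k. cont_diff k f) \<and> bdd_supp f"

lemma test_fields_iff:
  fixes \<phi> :: "real^'n \<Rightarrow> real^'m"
  shows "\<phi> \<in> test_fields \<longleftrightarrow> test_fn \<phi>"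
proof -
  have "compact (closure {x. \<phi> x \<noteq> 0}) \<longleftrightarrow> bdd_supp \<phi>"
  proof
    assume "compact (closure {x. \<phi> x \<noteq> 0})"
    then have "bounded {x. \<phi> x \<noteq> 0}" by simp
    then obtain R where "\<And>x. \<phi> x \<noteq> 0 \<Longrightarrow> norm x \<le> R" by (auto simp: bounded_iff)
    then show "bdd_supp \<phi>" unfolding bdd_supp_def by (metis not_le)
  next
    assume "bdd_supp \<phi>"
    then have "bounded {x. \<phi> x \<noteq> 0}"
      unfolding bounded_iff bdd_supp_def by (metis (mono_tags, lifting) mem_Collect_eq not_le)
    then show "compact (closure {x. \<phi> x \<noteq> 0})" by simp
  qed
  then show ?thesis by (simp add: test_fields_def test_fn_def C_k_iff_cont_diff)
qed

lemma test_fn_continuous: "test_fn f \<Longrightarrow> continuous_on UNIV f"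
  using cont_diff_imp_continuous by (auto simp: test_fn_def)

lemma test_fn_bdd_lip:
  fixes f :: "'a::euclidean_space \<Rightarrow> 'b::real_normed_vector"
  assumes "test_fn f" obtains M where "bdd_lip M f"
  using assms bdd_supp_cont_diff_bdd_lip[of f] by (auto simp: test_fn_def)

lemma test_fn_bounded:
  fixes f :: "'a::euclidean_space \<Rightarrow> 'b::real_normed_vector"
  assumes "test_fn f" obtains A where "\<And>x. norm (f x) \<le> A"
  using assms bdd_supp_bounded[of f] test_fn_continuous[of f] by (auto simp: test_fn_def)

lemma test_fn_has_derivative:
  assumes "test_fn f" shows "(f has_derivative frechet_derivative f (at x)) (at x)"
  using assms cont_diff_Suc_has_derivative[of 0 f] by (simp add: test_fn_def)

lemma test_fn_frechet_derivative:
  assumes "test_fn f"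
  shows "test_fn (\<lambda>x. frechet_derivative f (at x) v)"
proof -
  have c: "cont_diff (Suc k) f" for k using assms unfolding test_fn_def by blast
  have "bdd_supp (\<lambda>x. frechet_derivative f (at x) v)"
    using assms c[of 0] unfolding cont_diff.simps by (intro bdd_supp_frechet_derivative) (simp_all add: test_fn_def)
  moreover have "cont_diff k (\<lambda>x. frechet_derivative f (at x) v)" for k
    using c[of k] by simp
  ultimately show ?thesis by (simp add: test_fn_def)
qed

lemma test_fn_integrable:
  fixes f :: "'a::euclidean_space \<Rightarrow> 'b::euclidean_space"
  assumes "test_fn f"
  shows "integrable lborel f"
proof -
  obtain R where R: "\<And>x. R < norm x \<Longrightarrow> f x = 0"
    using assms by (auto simp: test_fn_def bdd_supp_def)
  have "integrable lborel (\<lambda>x. indicator (cball 0 R) x *\<^sub>R f x)"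
    by (intro borel_integrable_compact continuous_on_subset[OF test_fn_continuous[OF assms]]) auto
  moreover have "(\<lambda>x. indicator (cball 0 R) x *\<^sub>R f x) = f"
    using R by (force simp: indicator_def)
  ultimately show ?thesis by simp
qed

text \<open>A supremum of reals carries information only for a set bounded above. Test functions are
  bounded, so the constraint in \<open>frac_perimeter_var\<close> really is the pointwise
  bound.\<close>

lemma SUP_norm_le_iff:
  fixes f :: "'a::euclidean_space \<Rightarrow> 'b::real_normed_vector"
  assumes "test_fn f"
  shows "(SUP x. norm (f x)) \<le> c \<longleftrightarrow> (\<forall>x. norm (f x) \<le> c)"
proof -
  obtain A where "\<And>x. norm (f x) \<le> A" using test_fn_bounded[OF assms] by blast
  then have "bdd_above (range (\<lambda>x. norm (f x)))" by (auto intro!: bdd_aboveI)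
  then show ?thesis
    by (meson UNIV_I UNIV_not_empty cSUP_least cSUP_upper order_trans)
qed

section \<open>Integrals against product measures and Lebesgue measure\<close>

text \<open>All Fubini exchanges below but one get joint integrability from such a product
  bound.\<close>

lemma integrable_pair_dominated:
  fixes f :: "'a \<times> 'b \<Rightarrow> 'c::{banach, second_countable_topology}"
    and a :: "'a \<Rightarrow> real" and b :: "'b \<Rightarrow> real"
  assumes M2: "sigma_finite_measure M2"
    and f: "f \<in> borel_measurable (M1 \<Otimes>\<^sub>M M2)"
    and a: "integrable M1 a" and b: "integrable M2 b"
    and le: "\<And>x y. x \<in> space M1 \<Longrightarrow> y \<in> space M2 \<Longrightarrow> norm (f (x, y)) \<le> a x * b y"
  shows "integrable (M1 \<Otimes>\<^sub>M M2) f"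
proof (rule integrableI_bounded[OF f])
  interpret M2: sigma_finite_measure M2 by fact
  have [measurable]: "a \<in> borel_measurable M1" "b \<in> borel_measurable M2"
    using a b by auto
  have "(\<integral>\<^sup>+p. ennreal (norm (f p)) \<partial>(M1 \<Otimes>\<^sub>M M2))
      \<le> (\<integral>\<^sup>+p. ennreal (norm (a (fst p))) * ennreal (norm (b (snd p))) \<partial>(M1 \<Otimes>\<^sub>M M2))"
  proof (rule nn_integral_mono)
    fix p assume "p \<in> space (M1 \<Otimes>\<^sub>M M2)"
    then have "norm (f p) \<le> a (fst p) * b (snd p)"
      using le[of "fst p" "snd p"] by (auto simp: space_pair_measure)
    also have "\<dots> \<le> norm (a (fst p)) * norm (b (snd p))"
      by (metis abs_ge_self norm_mult real_norm_def)
    finally show "ennreal (norm (f p)) \<le> ennreal (norm (a (fst p))) * ennreal (norm (b (snd p)))"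
      by (simp add: ennreal_mult[symmetric] ennreal_leI)
  qed
  also have "\<dots> = (\<integral>\<^sup>+x. \<integral>\<^sup>+y. ennreal (norm (a x)) * ennreal (norm (b y)) \<partial>M2 \<partial>M1)"
    by (subst M2.nn_integral_fst[symmetric]) auto
  also have "\<dots> = (\<integral>\<^sup>+x. ennreal (norm (a x)) \<partial>M1) * (\<integral>\<^sup>+y. ennreal (norm (b y)) \<partial>M2)"
    by (simp add: nn_integral_cmult nn_integral_multc)
  also have "\<dots> < \<infinity>"
    using a b by (simp add: integrable_iff_bounded ennreal_mult_less_top)
  finally show "(\<integral>\<^sup>+p. ennreal (norm (f p)) \<partial>(M1 \<Otimes>\<^sub>M M2)) < \<infinity>" .
qed

lemma
  fixes f :: "'a::euclidean_space \<Rightarrow> 'b::{banach, second_countable_topology}"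
  assumes [measurable]: "f \<in> borel_measurable borel"
  shows lborel_integral_shift: "(LINT x|lborel. f (t + x)) = (LINT x|lborel. f x)"
    and lborel_integrable_shift: "integrable lborel (\<lambda>x. f (t + x)) \<longleftrightarrow> integrable lborel f"
  using integral_distr[of "(+) t" lborel borel f] integrable_distr_eq[of "(+) t" lborel borel f]
  by (simp_all add: lborel_distr_plus)

lemma lborel_integral_scale:
  fixes f :: "'a::euclidean_space \<Rightarrow> real"
  assumes [measurable]: "f \<in> borel_measurable borel" and "0 < c"
  shows "(LINT x|lborel. f x) = c ^ DIM('a) * (LINT x|lborel. f (c *\<^sub>R x))"
proof -
  have "(LINT x|lborel. f x)
      = (LINT x|density (distr lborel borel (\<lambda>x::'a. 0 + c *\<^sub>R x)) (\<lambda>_. \<bar>c\<bar> ^ DIM('a)). f x)"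
    using lborel_affine[of c "0::'a"] assms(2) by auto
  also have "\<dots> = c ^ DIM('a) * (LINT x|lborel. f (c *\<^sub>R x))"
    using assms(2) by (subst integral_density) (auto simp: integral_distr)
  finally show ?thesis .
qed

lemma
  fixes f :: "'a::euclidean_space \<Rightarrow> real \<Rightarrow> 'b::{real_normed_field, banach, second_countable_topology}"
  assumes f: "\<And>b. b \<in> Basis \<Longrightarrow> integrable lborel (f b)"
  shows integrable_lborel_prod: "integrable lborel (\<lambda>x::'a. \<Prod>b\<in>Basis. f b (x \<bullet> b))"
    and integral_lborel_prod:
      "(LINT x|lborel. (\<Prod>b\<in>(Basis::'a set). f b (x \<bullet> b))) = (\<Prod>b\<in>Basis. (LINT x|lborel. f b x))"
proof -
  interpret product_sigma_finite "\<lambda>_::'a. lborel :: real measure" by standard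
  have [measurable]: "\<And>b. b \<in> Basis \<Longrightarrow> f b \<in> borel_measurable borel"
    using f by (auto dest: borel_measurable_integrable)
  let ?T = "\<lambda>x. \<Sum>b\<in>Basis. x b *\<^sub>R (b::'a)"
  have T: "?T \<in> (\<Pi>\<^sub>M b\<in>Basis. lborel) \<rightarrow>\<^sub>M borel" by measurable
  have m: "(\<lambda>x::'a. \<Prod>b\<in>Basis. f b (x \<bullet> b)) \<in> borel_measurable borel" by measurable
  have eq: "(\<Prod>b\<in>Basis. f b (?T x \<bullet> b)) = (\<Prod>b\<in>Basis. f b (x b))" for x
    by (intro prod.cong refl arg_cong2[where f=f]) (simp add: inner_sum_left inner_Basis if_distrib cong: if_cong)
  show "integrable lborel (\<lambda>x::'a. \<Prod>b\<in>Basis. f b (x \<bullet> b))"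
    by (subst lborel_eq, subst integrable_distr_eq[OF T m])
       (simp only: eq, intro product_integrable_prod f finite_Basis)
  show "(LINT x|lborel. (\<Prod>b\<in>(Basis::'a set). f b (x \<bullet> b))) = (\<Prod>b\<in>Basis. (LINT x|lborel. f b x))"
    by (subst lborel_eq, subst integral_distr[OF T m])
       (simp only: eq, intro product_integral_prod f finite_Basis)
qed

section \<open>Stable Levy measures\<close>

text \<open>Sigma-finiteness serves the Fubini exchanges, the weighted moment makes gradients and
  divergences converge, and symmetry supplies the sign in \<open>duality\<close>.\<close>

locale symmetric_levy_measure = sigma_finite_measure \<nu> for \<nu> :: "'a::euclidean_space measure" +
  assumes sets_nu [measurable_cong]: "sets \<nu> = sets borel"
    and moment: "integrable \<nu> (\<lambda>u. min 1 (norm u) * norm u)"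
    and symmetric: "distr \<nu> borel uminus = \<nu>"

lemma sphere_measure_id:
  assumes "symmetric_sphere_measure \<sigma>"
  shows "(\<lambda>x. x) \<in> \<sigma> \<rightarrow>\<^sub>M borel" "space \<sigma> = sphere 0 1"
proof -
  have s: "sets \<sigma> = sets (restrict_space borel (sphere 0 1))"
    using assms by (simp add: symmetric_sphere_measure_def)
  show "space \<sigma> = sphere 0 1"
    using sets_eq_imp_space_eq[OF s] by (simp add: space_restrict_space)
  have "(\<lambda>x. x) \<in> borel_measurable (restrict_space borel (sphere 0 1))"
    by (intro measurable_restrict_space1) simp
  with s show "(\<lambda>x. x) \<in> \<sigma> \<rightarrow>\<^sub>M borel" by (simp cong: measurable_cong_sets)
qed

lemma sets_stable_levy_measure: "sets (stable_levy_measure \<alpha> \<sigma>) = sets borel"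
  using sets.sigma_sets_eq[of "borel :: (real^'n) measure"]
  by (simp add: stable_levy_measure_def sets_measure_of_conv)

text \<open>Integration in polar coordinates: the Levy measure is the image of a weighted product
  measure on directions and radii under multiplication. Both measures agree on sets, and integrals
  against the image are computed by Tonelli.\<close>

lemma nn_integral_stable_levy_measure:
  fixes \<sigma> :: "(real^'n) measure"
  assumes \<sigma>: "symmetric_sphere_measure \<sigma>" and g: "g \<in> borel_measurable borel"
  shows "(\<integral>\<^sup>+u. g u \<partial>stable_levy_measure \<alpha> \<sigma>) =
    (\<integral>\<^sup>+y. (\<integral>\<^sup>+r. g (r *\<^sub>R y) * ennreal (1 / r powr (\<alpha> + 1)) * indicator {0<..} r \<partial>lborel) \<partial>\<sigma>)"
proof -
  note [measurable] = sphere_measure_id(1)[OF \<sigma>]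
  define w where "w = (\<lambda>p::(real^'n) \<times> real. ennreal (1 / snd p powr (\<alpha> + 1)) * indicator {0<..} (snd p))"
  define D where "D = distr (density (\<sigma> \<Otimes>\<^sub>M lborel) w) borel (\<lambda>p. snd p *\<^sub>R fst p)"
  have [measurable]: "w \<in> borel_measurable (\<sigma> \<Otimes>\<^sub>M lborel)" unfolding w_def by measurable
  have D: "(\<integral>\<^sup>+u. h u \<partial>D) =
    (\<integral>\<^sup>+y. (\<integral>\<^sup>+r. h (r *\<^sub>R y) * ennreal (1 / r powr (\<alpha> + 1)) * indicator {0<..} r \<partial>lborel) \<partial>\<sigma>)"
    if [measurable]: "h \<in> borel_measurable borel" for h
  proof -
    have "(\<integral>\<^sup>+u. h u \<partial>D) = (\<integral>\<^sup>+p. h (snd p *\<^sub>R fst p) \<partial>density (\<sigma> \<Otimes>\<^sub>M lborel) w)"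
      unfolding D_def by (rule nn_integral_distr) auto
    also have "\<dots> = (\<integral>\<^sup>+p. w p * h (snd p *\<^sub>R fst p) \<partial>(\<sigma> \<Otimes>\<^sub>M lborel))"
      by (rule nn_integral_density) auto
    also have "\<dots> = (\<integral>\<^sup>+y. \<integral>\<^sup>+r. w (y, r) * h (r *\<^sub>R y) \<partial>lborel \<partial>\<sigma>)"
      by (subst lborel.nn_integral_fst[symmetric]) auto
    finally show ?thesis by (simp add: w_def mult_ac)
  qed
  have "stable_levy_measure \<alpha> \<sigma> = D"
  proof (rule measure_eqI)
    fix B assume "B \<in> sets (stable_levy_measure \<alpha> \<sigma>)"
    then have B: "B \<in> sets borel" by (simp add: sets_stable_levy_measure)
    have "emeasure D B = (\<integral>\<^sup>+u. indicator B u \<partial>D)" using B by (simp add: D_def)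
    also have "\<dots> = emeasure (stable_levy_measure \<alpha> \<sigma>) B"
      using B by (simp add: D emeasure_stable_levy_measure[OF \<sigma>])
    finally show "emeasure (stable_levy_measure \<alpha> \<sigma>) B = emeasure D B" ..
  qed (simp add: sets_stable_levy_measure D_def)
  with D[OF g] show ?thesis by simp
qed

text \<open>The integrand is r^(1 - \<alpha>) below 1 and r^(-\<alpha>) above 1; the first is
  integrable because \<alpha> < 2, the second because \<alpha> > 1.\<close>

lemma radial_moment_finite:
  fixes \<alpha> :: real
  assumes "1 < \<alpha>" "\<alpha> < 2"
  shows "(\<integral>\<^sup>+r. ennreal (min 1 r * r) * ennreal (1 / r powr (\<alpha> + 1)) * indicator {0<..} r \<partial>lborel) < \<infinity>"
proof -
  have "(\<integral>\<^sup>+r. ennreal (min 1 r * r) * ennreal (1 / r powr (\<alpha> + 1)) * indicator {0<..} r \<partial>lborel)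
    \<le> (\<integral>\<^sup>+r. ennreal (r powr (1 - \<alpha>)) * indicator {0..1} r
          + ennreal (r powr (- \<alpha>)) * indicator {1..} r \<partial>lborel)"
  proof (rule nn_integral_mono)
    fix r :: real
    show "ennreal (min 1 r * r) * ennreal (1 / r powr (\<alpha> + 1)) * indicator {0<..} r
      \<le> ennreal (r powr (1 - \<alpha>)) * indicator {0..1} r + ennreal (r powr (- \<alpha>)) * indicator {1..} r"
    proof (cases "0 < r")
      case True
      then have p: "r powr (\<alpha> + 1) = r * r powr \<alpha>" by (simp add: powr_add)
      from True show ?thesis
        by (auto simp: p indicator_def ennreal_mult[symmetric] min_def powr_minus powr_diff
            divide_simps intro!: ennreal_leI)
    qed simp
  qed
  also have "\<dots> = (\<integral>\<^sup>+r. ennreal (r powr (1 - \<alpha>)) * indicator {0..1} r \<partial>lborel)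
      + (\<integral>\<^sup>+r. ennreal (r powr (- \<alpha>)) * indicator {1..} r \<partial>lborel)"
    by (rule nn_integral_add) auto
  also have "\<dots> < \<infinity>"
    using nn_integral_has_integral_lebesgue'[OF _ has_integral_powr_from_0[of "1 - \<alpha>" 1]]
      nn_integral_has_integral_lebesgue'[OF _ has_integral_powr_to_inf[of "- \<alpha>" 1]] assms
    by simp
  finally show ?thesis .
qed

text \<open>Symmetry is given through images of sets; since negation is its own inverse, images are
  preimages and symmetry becomes invariance under a push-forward.\<close>

lemma symmetric_sphere_measure_distr:
  assumes "symmetric_sphere_measure \<sigma>"
  shows "uminus \<in> \<sigma> \<rightarrow>\<^sub>M \<sigma>" "distr \<sigma> \<sigma> uminus = \<sigma>"
proof -
  note [measurable] = sphere_measure_id(1)[OF assms]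
  have s: "sets \<sigma> = sets (restrict_space borel (sphere 0 1))"
    and eq: "\<And>B. B \<in> sets \<sigma> \<Longrightarrow> emeasure \<sigma> (uminus ` B) = emeasure \<sigma> B"
    using assms by (auto simp: symmetric_sphere_measure_def)
  have "uminus \<in> \<sigma> \<rightarrow>\<^sub>M restrict_space borel (sphere 0 1)"
    by (intro measurable_restrict_space2) (auto simp: sphere_measure_id(2)[OF assms])
  then show m: "uminus \<in> \<sigma> \<rightarrow>\<^sub>M \<sigma>" using s by (simp cong: measurable_cong_sets)
  show "distr \<sigma> \<sigma> uminus = \<sigma>"
  proof (rule measure_eqI)
    fix B assume "B \<in> sets (distr \<sigma> \<sigma> uminus)"
    then have B: "B \<in> sets \<sigma>" by simp
    have "uminus -` B \<inter> space \<sigma> = uminus ` B"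
      using sets.sets_into_space[OF B] unfolding sphere_measure_id(2)[OF assms]
      by (auto simp: image_iff) (metis minus_minus)+
    then show "emeasure (distr \<sigma> \<sigma> uminus) B = emeasure \<sigma> B"
      using m B eq by (simp add: emeasure_distr)
  qed simp
qed

lemma symmetric_levy_measure_stable:
  fixes \<sigma> :: "(real^'n) measure"
  assumes \<alpha>: "1 < \<alpha>" "\<alpha> < 2" and \<sigma>: "symmetric_sphere_measure \<sigma>"
  shows "symmetric_levy_measure (stable_levy_measure \<alpha> \<sigma>)"
proof -
  let ?\<nu> = "stable_levy_measure \<alpha> \<sigma>"
  note nn = nn_integral_stable_levy_measure[OF \<sigma>, where \<alpha> = \<alpha>]
  note [measurable] = sphere_measure_id(1)[OF \<sigma>]
  note [measurable_cong] = sets_stable_levy_measure[of \<alpha> \<sigma>]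
  interpret \<sigma>: finite_measure \<sigma> using \<sigma> by (simp add: symmetric_sphere_measure_def)
  let ?c = "\<integral>\<^sup>+r. ennreal (min 1 r * r) * ennreal (1 / r powr (\<alpha> + 1)) * indicator {0<..} r \<partial>lborel"
  have mom: "(\<integral>\<^sup>+u. ennreal (min 1 (norm u) * norm u) \<partial>?\<nu>) < \<infinity>"
  proof -
    have "(\<integral>\<^sup>+u. ennreal (min 1 (norm u) * norm u) \<partial>?\<nu>) = (\<integral>\<^sup>+y. ?c \<partial>\<sigma>)"
      by (subst nn, measurable, intro nn_integral_cong)
         (auto simp: sphere_measure_id(2)[OF \<sigma>] indicator_def)
    also have "\<dots> < \<infinity>"
      using radial_moment_finite[OF \<alpha>] by (simp add: ennreal_mult_less_top \<sigma>.emeasure_eq_measure)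
    finally show ?thesis .
  qed
  have mm: "(\<lambda>u. min 1 (norm u) * norm u) \<in> borel_measurable ?\<nu>"
    by (subst measurable_cong_sets[OF sets_stable_levy_measure refl])
       (intro borel_measurable_continuous_onI continuous_intros)
  with mom have int: "integrable ?\<nu> (\<lambda>u. min 1 (norm u) * norm u)"
    by (intro integrableI_bounded) auto
  have "sigma_finite_measure ?\<nu>"
  proof
    \<comment> \<open>By Markov's inequality for the weighted moment each of these sets has finite
      measure. They cover everything but the origin, which is null because directions are unit
      vectors and radii are positive.\<close>
    let ?A = "\<lambda>n. {u::real^'n. 1 / real (Suc n) \<le> min 1 (norm u) * norm u}"
    have "emeasure ?\<nu> {0} = (\<integral>\<^sup>+u. indicator {0} u \<partial>?\<nu>)"
      by (simp add: sets_stable_levy_measure)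
    also have "\<dots> = (\<integral>\<^sup>+y. (\<integral>\<^sup>+r. indicator {0} (r *\<^sub>R y) * ennreal (1 / r powr (\<alpha> + 1))
        * indicator {0<..} r \<partial>lborel) \<partial>\<sigma>)"
      by (rule nn) simp
    also have "\<dots> = (\<integral>\<^sup>+y. (\<integral>\<^sup>+r. 0 \<partial>(lborel :: real measure)) \<partial>\<sigma>)"
    proof (intro nn_integral_cong)
      fix y r assume "y \<in> space \<sigma>"
      then have "y \<noteq> 0" by (auto simp: sphere_measure_id(2)[OF \<sigma>])
      then show "indicator {0} (r *\<^sub>R y) * ennreal (1 / r powr (\<alpha> + 1)) * indicator {0<..} r = 0"
        by (simp add: indicator_def)
    qed
    finally have 0: "emeasure ?\<nu> {0} = 0" by simp
    have A: "emeasure ?\<nu> (?A n) \<noteq> \<infinity>" for n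
    proof -
      have "emeasure ?\<nu> (?A n) = (\<integral>\<^sup>+u. indicator (?A n) u \<partial>?\<nu>)"
        by (intro nn_integral_indicator[symmetric]) measurable
      also have "\<dots> \<le> (\<integral>\<^sup>+u. ennreal (real (Suc n)) * ennreal (min 1 (norm u) * norm u) \<partial>?\<nu>)"
        by (intro nn_integral_mono)
           (auto simp: indicator_def ennreal_mult[symmetric] divide_simps mult.commute simp del: of_nat_Suc)
      also have "\<dots> < \<infinity>"
        using mom mm
        by (subst nn_integral_cmult) (auto simp: ennreal_mult_less_top simp del: of_nat_Suc)
      finally show ?thesis by simp
    qed
    have cover: "u \<in> \<Union> (insert {0} (range ?A))" for u :: "real^'n"
    proof (cases "u = 0")
      case False
      then obtain n where "inverse (real (Suc n)) < min 1 (norm u) * norm u"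
        using reals_Archimedean[of "min 1 (norm u) * norm u"] by auto
      then show ?thesis by (auto simp: inverse_eq_divide intro!: less_imp_le)
    qed auto
    have "\<Union> (insert {0} (range ?A)) = UNIV" using cover by (intro equalityI subset_UNIV subsetI)
    moreover have "insert {0} (range ?A) \<subseteq> sets ?\<nu>"
      by (auto simp: sets_stable_levy_measure simp del: of_nat_Suc)
    ultimately show "\<exists>A. countable A \<and> A \<subseteq> sets ?\<nu> \<and> \<Union> A = space ?\<nu> \<and> (\<forall>a\<in>A. emeasure ?\<nu> a \<noteq> \<infinity>)"
      using 0 A sets_eq_imp_space_eq[OF sets_stable_levy_measure[of \<alpha> \<sigma>]]
      by (intro exI[of _ "insert {0} (range ?A)"]) (auto simp del: of_nat_Suc Union_insert)
  qed
  moreover have "distr ?\<nu> borel uminus = ?\<nu>"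
  proof (rule measure_eqI)
    fix B assume "B \<in> sets (distr ?\<nu> borel uminus)"
    then have [measurable]: "B \<in> sets borel" by simp
    let ?H = "\<lambda>y. \<integral>\<^sup>+r. indicator B (r *\<^sub>R y) * ennreal (1 / r powr (\<alpha> + 1)) * indicator {0<..} r \<partial>lborel"
    have [measurable]: "?H \<in> borel_measurable \<sigma>" by measurable
    have "emeasure (distr ?\<nu> borel uminus) B = (\<integral>\<^sup>+u. indicator B u \<partial>distr ?\<nu> borel uminus)"
      by simp
    also have "\<dots> = (\<integral>\<^sup>+u. indicator B (- u) \<partial>?\<nu>)"
      by (rule nn_integral_distr) (simp_all add: measurable_cong_sets[OF sets_stable_levy_measure refl])
    also have "\<dots> = (\<integral>\<^sup>+y. ?H (- y) \<partial>\<sigma>)"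
      by (subst nn) auto
    also have "\<dots> = (\<integral>\<^sup>+y. ?H y \<partial>distr \<sigma> \<sigma> uminus)"
      using symmetric_sphere_measure_distr(1)[OF \<sigma>] by (subst nn_integral_distr) auto
    also have "\<dots> = (\<integral>\<^sup>+u. indicator B u \<partial>?\<nu>)"
      by (subst nn) (auto simp: symmetric_sphere_measure_distr(2)[OF \<sigma>])
    also have "\<dots> = emeasure ?\<nu> B"
      by (simp add: sets_stable_levy_measure)
    finally show "emeasure (distr ?\<nu> borel uminus) B = emeasure ?\<nu> B" .
  qed (simp add: sets_stable_levy_measure)
  ultimately show ?thesis
    using int by (simp add: symmetric_levy_measure_def symmetric_levy_measure_axioms_def sets_stable_levy_measure)
qed

section \<open>Fourier transforms of Gaussians\<close>

text \<open>Both parts come from the characteristic function of the standard normal law by the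
  substitution of \<epsilon> x for x. The factor \<open>2 * pi\<close> is what remains when the
  resulting Gaussian in \<open>w\<close> is normalised to a density.\<close>

lemma
  fixes \<epsilon> w :: real
  assumes "0 < \<epsilon>"
  shows integrable_gauss_1d:
      "integrable lborel (\<lambda>x. iexp (w * x) * complex_of_real (exp (- (\<epsilon>\<^sup>2 * x\<^sup>2) / 2)))"
    and fourier_gauss_1d:
      "(CLINT x|lborel. iexp (w * x) * complex_of_real (exp (- (\<epsilon>\<^sup>2 * x\<^sup>2) / 2)))
        = complex_of_real (2 * pi * normal_density 0 \<epsilon> w)"
proof -
  let ?f = "\<lambda>x. complex_of_real (std_normal_density x) * iexp (w / \<epsilon> * x)"
  let ?g = "\<lambda>x. iexp (w * x) * complex_of_real (exp (- (\<epsilon>\<^sup>2 * x\<^sup>2) / 2))"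
  have f: "integrable lborel ?f"
    by (rule Bochner_Integration.integrable_bound[OF integrable_normal_density[where \<mu> = 0 and \<sigma> = 1]])
       (auto simp: norm_mult normal_density_nonneg)
  have scale: "?f (0 + \<epsilon> * x) = complex_of_real (1 / sqrt (2 * pi)) * ?g x" for x
    using assms by (simp add: std_normal_density_def power_mult_distrib mult_ac)
  have "integrable lborel (\<lambda>x. ?f (0 + \<epsilon> * x))"
    by (rule lborel_integrable_real_affine[OF f]) (use assms in simp)
  then have "integrable lborel (\<lambda>x. complex_of_real (sqrt (2 * pi)) * ?f (0 + \<epsilon> * x))"
    by (rule integrable_mult_right)
  then show "integrable lborel ?g"
    unfolding scale by (simp add: mult.assoc[symmetric] of_real_mult[symmetric] del: of_real_mult)
  have "complex_of_real (exp (- ((w / \<epsilon>)\<^sup>2) / 2)) = char std_normal_distribution (w / \<epsilon>)"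
    by (simp add: char_std_normal_distribution)
  also have "\<dots> = (CLINT x|lborel. ?f x)"
    unfolding char_def
    by (subst integral_density) (auto simp: scaleR_conv_of_real normal_density_nonneg)
  also have "\<dots> = \<epsilon> *\<^sub>R (CLINT x|lborel. ?f (0 + \<epsilon> * x))"
    using lborel_integral_real_affine[of \<epsilon> ?f 0] assms by simp
  also have "\<dots> = complex_of_real (\<epsilon> / sqrt (2 * pi)) * (CLINT x|lborel. ?g x)"
    unfolding scale by (simp add: scaleR_conv_of_real)
  finally have "(CLINT x|lborel. ?g x)
      = complex_of_real (exp (- ((w / \<epsilon>)\<^sup>2) / 2)) / complex_of_real (\<epsilon> / sqrt (2 * pi))"
    using assms by (simp add: field_simps)
  also have "\<dots> = complex_of_real (exp (- ((w / \<epsilon>)\<^sup>2) / 2) / (\<epsilon> / sqrt (2 * pi)))"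
    by simp
  also have "exp (- ((w / \<epsilon>)\<^sup>2) / 2) / (\<epsilon> / sqrt (2 * pi)) = 2 * pi * normal_density 0 \<epsilon> w"
  proof -
    have "2 * pi = sqrt (2 * pi) * sqrt (2 * pi)" by simp
    then show ?thesis
      using assms by (simp add: normal_density_def real_sqrt_mult power_divide field_simps)
  qed
  finally show "(CLINT x|lborel. ?g x) = complex_of_real (2 * pi * normal_density 0 \<epsilon> w)" .
qed

text \<open>The density of the centred normal law with covariance \<epsilon>^2 times the identity;
  \<open>gauss_hat\<close> is its characteristic function. The product form reduces every integral
  to dimension one.\<close>

definition gauss :: "real \<Rightarrow> 'a::euclidean_space \<Rightarrow> real" where
  "gauss \<epsilon> w = (\<Prod>b\<in>Basis. normal_density 0 \<epsilon> (w \<bullet> b))"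

definition gauss_hat :: "real \<Rightarrow> 'a::euclidean_space \<Rightarrow> real" where
  "gauss_hat \<epsilon> \<xi> = (\<Prod>b\<in>Basis. exp (- (\<epsilon>\<^sup>2 * (\<xi> \<bullet> b)\<^sup>2) / 2))"

lemma gauss_measurable [measurable]: "gauss \<epsilon> \<in> borel_measurable borel"
  unfolding gauss_def[abs_def] by measurable

lemma gauss_hat_measurable [measurable]: "gauss_hat \<epsilon> \<in> borel_measurable borel"
  unfolding gauss_hat_def[abs_def] by measurable

lemma gauss_nonneg: "0 \<le> gauss \<epsilon> w"
  by (simp add: gauss_def prod_nonneg normal_density_nonneg)

lemma gauss_bounded: obtains C where "\<And>w::'a::euclidean_space. gauss \<epsilon> w \<le> C"
proof -
  have "gauss \<epsilon> w \<le> (\<Prod>b\<in>(Basis::'a set). 1 / sqrt (2 * pi * \<epsilon>\<^sup>2))" for w :: 'a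
    unfolding gauss_def
    by (intro prod_mono conjI normal_density_nonneg)
       (auto simp: normal_density_def intro!: divide_right_mono)
  then show thesis by (rule that)
qed

lemma gauss_hat_bounds: "0 \<le> gauss_hat \<epsilon> \<xi>" "gauss_hat \<epsilon> \<xi> \<le> 1"
  unfolding gauss_hat_def by (auto intro!: prod_nonneg prod_le_1)

lemma integrable_gauss: "0 < \<epsilon> \<Longrightarrow> integrable lborel (gauss \<epsilon>)"
  and integral_gauss: "0 < \<epsilon> \<Longrightarrow> (LINT w|lborel. gauss \<epsilon> w) = 1"
  unfolding gauss_def[abs_def]
  by (auto intro!: integrable_lborel_prod simp: integral_lborel_prod[of "\<lambda>_. normal_density 0 \<epsilon>"])

lemma iexp_inner: "iexp (w \<bullet> \<xi>) = (\<Prod>b\<in>(Basis::'a::euclidean_space set). iexp ((w \<bullet> b) * (\<xi> \<bullet> b)))"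
  by (subst euclidean_inner) (simp add: sum_distrib_left exp_sum)

lemma
  fixes w :: "'a::euclidean_space"
  assumes "0 < \<epsilon>"
  shows integrable_gauss_hat_iexp:
      "integrable lborel (\<lambda>\<xi>. iexp (w \<bullet> \<xi>) * complex_of_real (gauss_hat \<epsilon> \<xi>))"
    and fourier_gauss:
      "(CLINT \<xi>|lborel. iexp (w \<bullet> \<xi>) * complex_of_real (gauss_hat \<epsilon> \<xi>))
        = complex_of_real ((2 * pi) ^ DIM('a) * gauss \<epsilon> w)"
proof -
  have eq: "iexp (w \<bullet> \<xi>) * complex_of_real (gauss_hat \<epsilon> \<xi>) =
    (\<Prod>b\<in>(Basis::'a set). iexp ((w \<bullet> b) * (\<xi> \<bullet> b)) * complex_of_real (exp (- (\<epsilon>\<^sup>2 * (\<xi> \<bullet> b)\<^sup>2) / 2)))" for \<xi>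
    by (simp only: iexp_inner gauss_hat_def prod.distrib of_real_prod)
  show "integrable lborel (\<lambda>\<xi>. iexp (w \<bullet> \<xi>) * complex_of_real (gauss_hat \<epsilon> \<xi>))"
    unfolding eq by (intro integrable_lborel_prod integrable_gauss_1d assms)
  show "(CLINT \<xi>|lborel. iexp (w \<bullet> \<xi>) * complex_of_real (gauss_hat \<epsilon> \<xi>))
        = complex_of_real ((2 * pi) ^ DIM('a) * gauss \<epsilon> w)"
    unfolding eq
    by (subst integral_lborel_prod[OF integrable_gauss_1d[OF assms]], subst fourier_gauss_1d[OF assms])
       (simp add: prod.distrib gauss_def)
qed

lemma integrable_gauss_hat:
  assumes "0 < \<epsilon>" shows "integrable lborel (gauss_hat \<epsilon> :: 'a::euclidean_space \<Rightarrow> real)"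
  using integrable_gauss_hat_iexp[OF assms, of "0::'a"] by (simp add: complex_of_real_integrable_eq)

lemma cmod_iexp_diff_le: "cmod (iexp a - iexp b) \<le> \<bar>a - b\<bar>"
proof -
  have "iexp a - iexp b = iexp b * (iexp (a - b) - 1)"
    by (simp add: algebra_simps exp_add[symmetric])
  then have "cmod (iexp a - iexp b) = cmod (iexp (a - b) - 1)"
    by (simp add: norm_mult)
  then show ?thesis using iexp_approx1[of "a - b" 0] by simp
qed

section \<open>Measures with decaying characteristic function\<close>

locale borel_prob = prob_space \<mu> for \<mu> :: "'a::euclidean_space measure" +
  assumes sets_mu [measurable_cong]: "sets \<mu> = sets borel"

text \<open>The decay condition is what bounds the gradient of a density of \<open>\<mu>\<close> by
  Fourier inversion. The characteristic function of a stable law is real, so \<open>q\<close> takes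
  real values.\<close>

locale fourier_decay = borel_prob \<mu> for \<mu> :: "'a::euclidean_space measure" +
  fixes q :: "'a \<Rightarrow> real"
  assumes cf: "\<And>\<xi>. (CLINT y|\<mu>. iexp (y \<bullet> \<xi>)) = complex_of_real (q \<xi>)"
    and decay: "integrable lborel (\<lambda>\<xi>. norm \<xi> * q \<xi>)"
begin

lemma q_measurable [measurable]: "q \<in> borel_measurable borel"
proof -
  have "q = (\<lambda>\<xi>. Re (CLINT y|\<mu>. iexp (y \<bullet> \<xi>)))" by (simp add: cf)
  also have "\<dots> \<in> borel_measurable borel" by measurable
  finally show ?thesis .
qed

lemma abs_q_le_1: "\<bar>q \<xi>\<bar> \<le> 1"
proof -
  have "\<bar>q \<xi>\<bar> = cmod (CLINT y|\<mu>. iexp (y \<bullet> \<xi>))" by (simp add: cf)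
  also have "\<dots> \<le> (LINT y|\<mu>. cmod (iexp (y \<bullet> \<xi>)))" by (rule integral_norm_bound)
  also have "\<dots> = 1" by (simp add: prob_space)
  finally show ?thesis .
qed

text \<open>The density at \<open>w\<close> of \<open>\<mu>\<close> convolved with the Gaussian of
  width \<epsilon>.\<close>

definition smoothed :: "real \<Rightarrow> 'a \<Rightarrow> real" where
  "smoothed \<epsilon> w = (LINT y|\<mu>. gauss \<epsilon> (y - w))"

text \<open>Fourier inversion for the smoothed law: \<open>gauss\<close> is replaced by its own
  Fourier integral, and the factor \<open>gauss_hat\<close> makes the double integral absolutely
  convergent, so the integrals may be exchanged.\<close>

lemma smoothed_fourier:
  assumes "0 < \<epsilon>"
  shows "complex_of_real ((2 * pi) ^ DIM('a) * smoothed \<epsilon> w)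
    = (CLINT \<xi>|lborel. iexp (- w \<bullet> \<xi>) * complex_of_real (gauss_hat \<epsilon> \<xi> * q \<xi>))"
proof -
  interpret pair_sigma_finite \<mu> lborel ..
  let ?f = "\<lambda>y \<xi>. iexp ((y - w) \<bullet> \<xi>) * complex_of_real (gauss_hat \<epsilon> \<xi>)"
  have int: "integrable (\<mu> \<Otimes>\<^sub>M lborel) (case_prod ?f)"
    by (rule integrable_pair_dominated[where a = "\<lambda>_. 1" and b = "gauss_hat \<epsilon>"])
       (auto simp: norm_mult gauss_hat_bounds integrable_gauss_hat[OF assms] lborel.sigma_finite_measure_axioms)
  have "complex_of_real ((2 * pi) ^ DIM('a) * smoothed \<epsilon> w)
    = (CLINT y|\<mu>. complex_of_real ((2 * pi) ^ DIM('a) * gauss \<epsilon> (y - w)))"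
    by (simp add: smoothed_def)
  also have "\<dots> = (CLINT y|\<mu>. (CLINT \<xi>|lborel. ?f y \<xi>))"
    by (simp only: fourier_gauss[OF assms])
  also have "\<dots> = (CLINT \<xi>|lborel. (CLINT y|\<mu>. ?f y \<xi>))"
    by (rule Fubini_integral[OF int, symmetric])
  also have "\<dots> = (CLINT \<xi>|lborel. iexp (- w \<bullet> \<xi>) * complex_of_real (gauss_hat \<epsilon> \<xi> * q \<xi>))"
  proof (rule Bochner_Integration.integral_cong[OF refl])
    fix \<xi>
    have "iexp ((y - w) \<bullet> \<xi>) = iexp (- w \<bullet> \<xi>) * iexp (y \<bullet> \<xi>)" for y
      by (simp add: inner_diff_left algebra_simps exp_add[symmetric])
    then have "?f y \<xi> = (iexp (- w \<bullet> \<xi>) * complex_of_real (gauss_hat \<epsilon> \<xi>)) * iexp (y \<bullet> \<xi>)" for y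
      by (simp only: mult_ac)
    then have "(CLINT y|\<mu>. ?f y \<xi>)
        = (CLINT y|\<mu>. (iexp (- w \<bullet> \<xi>) * complex_of_real (gauss_hat \<epsilon> \<xi>)) * iexp (y \<bullet> \<xi>))"
      by (simp only:)
    also have "\<dots> = (iexp (- w \<bullet> \<xi>) * complex_of_real (gauss_hat \<epsilon> \<xi>)) * complex_of_real (q \<xi>)"
      by (simp only: integral_mult_right_zero cf)
    finally show "(CLINT y|\<mu>. ?f y \<xi>) = iexp (- w \<bullet> \<xi>) * complex_of_real (gauss_hat \<epsilon> \<xi> * q \<xi>)"
      by (simp only: of_real_mult mult.assoc)
  qed
  finally show ?thesis .
qed

text \<open>The constant L of the overview, obtained by bringing the absolute value inside the
  inversion formula for the gradient of the density.\<close>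

definition lip :: real where
  "lip = (LINT \<xi>|lborel. norm \<xi> * \<bar>q \<xi>\<bar>) / (2 * pi) ^ DIM('a)"

lemma decay_abs: "integrable lborel (\<lambda>\<xi>. norm \<xi> * \<bar>q \<xi>\<bar>)"
  using integrable_norm[OF decay] by (simp add: abs_mult)

lemma lip_nonneg: "0 \<le> lip"
  unfolding lip_def by simp

text \<open>In the difference of two inversion integrals, \<open>gauss_hat\<close> is bounded by 1
  and the exponentials by the difference of their phases. The width disappears from the bound, which
  is what permits the later limit.\<close>

lemma smoothed_lipschitz:
  assumes "0 < \<epsilon>"
  shows "\<bar>smoothed \<epsilon> (w - u) - smoothed \<epsilon> w\<bar> \<le> lip * norm u"
proof -
  let ?c = "(2 * pi) ^ DIM('a)"
  let ?h = "\<lambda>w \<xi>. iexp (- w \<bullet> \<xi>) * complex_of_real (gauss_hat \<epsilon> \<xi> * q \<xi>)"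
  have int: "integrable lborel (?h w)" for w
    by (rule Bochner_Integration.integrable_bound[OF integrable_gauss_hat[OF assms]])
       (auto simp: norm_mult gauss_hat_bounds abs_mult abs_q_le_1 intro!: mult_left_le)
  have "?c * \<bar>smoothed \<epsilon> (w - u) - smoothed \<epsilon> w\<bar>
      = cmod (complex_of_real (?c * smoothed \<epsilon> (w - u)) - complex_of_real (?c * smoothed \<epsilon> w))"
    by (simp only: of_real_diff[symmetric] norm_of_real) (simp add: abs_mult right_diff_distrib[symmetric])
  also have "\<dots> = cmod (CLINT \<xi>|lborel. ?h (w - u) \<xi> - ?h w \<xi>)"
    unfolding smoothed_fourier[OF assms] by (subst Bochner_Integration.integral_diff[OF int int]) simp
  also have "\<dots> \<le> (LINT \<xi>|lborel. norm u * (norm \<xi> * \<bar>q \<xi>\<bar>))"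
  proof (rule Bochner_Integration.integral_norm_bound_integral)
    fix \<xi>
    have "cmod (?h (w - u) \<xi> - ?h w \<xi>)
      = cmod (iexp (- (w - u) \<bullet> \<xi>) - iexp (- w \<bullet> \<xi>)) * (gauss_hat \<epsilon> \<xi> * \<bar>q \<xi>\<bar>)"
      by (simp only: left_diff_distrib[symmetric] norm_mult norm_of_real abs_mult abs_of_nonneg[OF gauss_hat_bounds(1)])
    also have "\<dots> \<le> \<bar>- (w - u) \<bullet> \<xi> - - w \<bullet> \<xi>\<bar> * (1 * \<bar>q \<xi>\<bar>)"
      by (intro mult_mono cmod_iexp_diff_le gauss_hat_bounds mult_nonneg_nonneg) auto
    also have "\<dots> \<le> (norm u * norm \<xi>) * (1 * \<bar>q \<xi>\<bar>)"
      by (intro mult_right_mono) (auto simp: inner_diff_left Cauchy_Schwarz_ineq2)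
    finally show "cmod (?h (w - u) \<xi> - ?h w \<xi>) \<le> norm u * (norm \<xi> * \<bar>q \<xi>\<bar>)" by simp
    show "complex_integrable lborel (\<lambda>\<xi>. ?h (w - u) \<xi> - ?h w \<xi>)"
      by (rule Bochner_Integration.integrable_diff[OF int int])
  qed (use decay_abs in auto)
  also have "\<dots> = ?c * (lip * norm u)"
    by (simp add: lip_def)
  finally show ?thesis by (simp add: mult_le_cancel_left)
qed

lemma smoothed_measurable [measurable]: "smoothed \<epsilon> \<in> borel_measurable borel"
  unfolding smoothed_def[abs_def] by measurable

text \<open>A shift of variable and the evenness of \<open>gauss\<close> turn smoothing of
  \<open>g\<close> into smoothing of the law; the translation by \<open>u\<close> then acts on the
  smoothed density alone.\<close>

lemma integral_smoothed:
  fixes g :: "'a \<Rightarrow> real"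
  assumes g: "integrable lborel g"
  shows "integrable lborel (\<lambda>w. g w * smoothed \<epsilon> (w - u))" (is ?A)
    and "(LINT y|\<mu>. (LINT z|lborel. g (y + u + z) * gauss \<epsilon> z)) = (LINT w|lborel. g w * smoothed \<epsilon> (w - u))" (is ?B)
proof -
  interpret pair_sigma_finite \<mu> lborel ..
  have [measurable]: "g \<in> borel_measurable borel" using g by auto
  obtain C where C: "\<And>w::'a. gauss \<epsilon> w \<le> C" using gauss_bounded[of \<epsilon>] by metis
  have sym: "gauss \<epsilon> (- w) = gauss \<epsilon> w" for w :: 'a
    by (simp add: gauss_def normal_density_def)
  let ?f = "\<lambda>y w. g w * gauss \<epsilon> (y - (w - u))"
  have int: "integrable (\<mu> \<Otimes>\<^sub>M lborel) (case_prod ?f)"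
    by (rule integrable_pair_dominated[where a = "\<lambda>_. C" and b = "\<lambda>w. \<bar>g w\<bar>"])
       (auto simp: abs_mult gauss_nonneg mult.commute[of C] lborel.sigma_finite_measure_axioms
         intro!: mult_left_mono C g integrable_abs)
  have 1: "(LINT z|lborel. g (y + u + z) * gauss \<epsilon> z) = (LINT w|lborel. ?f y w)" for y
  proof -
    have "(LINT z|lborel. g (y + u + z) * gauss \<epsilon> z) = (LINT z|lborel. ?f y (y + u + z))"
      by (simp add: sym)
    also have "\<dots> = (LINT w|lborel. ?f y w)"
      by (rule lborel_integral_shift) measurable
    finally show ?thesis .
  qed
  have 2: "(LINT y|\<mu>. ?f y w) = g w * smoothed \<epsilon> (w - u)" for w
    by (simp add: smoothed_def)
  show ?A using integrable_snd[OF int] unfolding 2 .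
  show ?B unfolding 1 2[symmetric] by (rule Fubini_integral[OF int, symmetric])
qed

text \<open>Rescaling the inner variable moves the width from the Gaussian weight into the argument
  of \<open>g\<close>. Dominated convergence then applies with a fixed weight, first in
  \<open>z\<close> and then in \<open>y\<close>.\<close>

lemma smoothing_tendsto:
  fixes g :: "'a \<Rightarrow> real"
  assumes cont: "continuous_on UNIV g" and bound: "\<And>x. \<bar>g x\<bar> \<le> 1"
  shows "(\<lambda>n. LINT y|\<mu>. (LINT z|lborel. g (y + u + z) * gauss (1 / real (Suc n)) z))
    \<longlonglongrightarrow> (LINT y|\<mu>. g (y + u))"
proof -
  have [measurable]: "g \<in> borel_measurable borel"
    using cont by (rule borel_measurable_continuous_onI)
  let ?e = "\<lambda>n. 1 / real (Suc n)"
  have scale: "(LINT z|lborel. g (v + z) * gauss (?e n) z) = (LINT z|lborel. g (v + ?e n *\<^sub>R z) * gauss 1 z)" for v n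
  proof -
    have 1: "e * normal_density 0 e (e * x) = normal_density 0 1 x" if "0 < e" for e x :: real
      using that by (simp add: normal_density_def power_mult_distrib real_sqrt_mult)
    have "?e n ^ DIM('a) * gauss (?e n) (?e n *\<^sub>R z) = gauss 1 z" for z :: 'a
      unfolding gauss_def prod_constant[symmetric] prod.distrib[symmetric] inner_scaleR_left
      by (intro prod.cong refl 1) simp
    then show ?thesis
      by (subst lborel_integral_scale[where c = "?e n"])
         (auto simp: integral_mult_right_zero[symmetric] algebra_simps simp del: integral_mult_right_zero
           intro!: Bochner_Integration.integral_cong)
  qed
  have inner: "(\<lambda>n. LINT z|lborel. g (v + ?e n *\<^sub>R z) * gauss 1 z) \<longlonglongrightarrow> (LINT z|lborel. g v * gauss 1 (z::'a))" for v
  proof (rule integral_dominated_convergence[where w = "gauss 1"])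
    have "(\<lambda>n. v + ?e n *\<^sub>R z) \<longlonglongrightarrow> v + 0 *\<^sub>R z" for z
      by (intro tendsto_intros LIMSEQ_Suc[OF lim_1_over_n])
    then have "(\<lambda>n. g (v + ?e n *\<^sub>R z)) \<longlonglongrightarrow> g v" for z
      by (intro continuous_on_tendsto_compose[OF cont]) auto
    then show "AE z in lborel. (\<lambda>n. g (v + ?e n *\<^sub>R z) * gauss 1 z) \<longlonglongrightarrow> g v * gauss 1 z"
      by (intro AE_I2 tendsto_mult_right)
    show "AE z in lborel. norm (g (v + ?e n *\<^sub>R z) * gauss 1 z) \<le> gauss 1 z" for n
      by (auto simp: abs_mult gauss_nonneg bound intro!: mult_left_le_one_le)
  qed (auto simp: integrable_gauss)
  have "(\<lambda>n. LINT y|\<mu>. (LINT z|lborel. g (y + u + ?e n *\<^sub>R z) * gauss 1 z))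
      \<longlonglongrightarrow> (LINT y|\<mu>. g (y + u))"
  proof (rule integral_dominated_convergence[where w = "\<lambda>_. 1"])
    show "AE y in \<mu>. (\<lambda>n. LINT z|lborel. g (y + u + ?e n *\<^sub>R z) * gauss 1 z) \<longlonglongrightarrow> g (y + u)"
      using inner by (simp add: integral_gauss)
    show "AE y in \<mu>. norm (LINT z|lborel. g (y + u + ?e n *\<^sub>R z) * gauss 1 z) \<le> 1" for n
    proof (rule AE_I2)
      fix y
      have "norm (LINT z|lborel. g (y + u + ?e n *\<^sub>R z) * gauss 1 z) \<le> (LINT z|lborel. gauss 1 (z::'a))"
        by (rule Bochner_Integration.integral_norm_bound_integral)
           (auto simp: abs_mult gauss_nonneg bound integrable_gauss intro!: AE_I2 mult_left_le_one_le
             Bochner_Integration.integrable_bound[OF integrable_gauss[of 1]])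
      then show "norm (LINT z|lborel. g (y + u + ?e n *\<^sub>R z) * gauss 1 z) \<le> 1"
        by (simp add: integral_gauss)
    qed
  qed auto
  then show ?thesis by (simp only: scale)
qed

text \<open>The two smoothed expectations differ by an integral of \<open>g\<close> against the
  difference of two values of \<open>smoothed\<close>; nonnegativity of \<open>g\<close> lets
  \<open>smoothed_lipschitz\<close> be applied under the integral, and the estimate survives the
  limit of vanishing width.\<close>

lemma translate_continuous_le:
  fixes g :: "'a \<Rightarrow> real"
  assumes cont: "continuous_on UNIV g" and bound: "\<And>x. 0 \<le> g x" "\<And>x. g x \<le> 1"
    and int: "integrable lborel g"
  shows "(LINT y|\<mu>. g (y + u)) \<le> (LINT y|\<mu>. g y) + lip * norm u * (LINT x|lborel. g x)"
proof -
  let ?S = "\<lambda>(n::nat) u. LINT y|\<mu>. (LINT z|lborel. g (y + u + z) * gauss (1 / real (Suc n)) z)"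
  have lim: "(\<lambda>n. ?S n u) \<longlonglongrightarrow> (LINT y|\<mu>. g (y + u))" for u
    by (rule smoothing_tendsto[OF cont]) (use bound in auto)
  have "?S n u \<le> ?S n 0 + lip * norm u * (LINT x|lborel. g x)" for n
  proof -
    have e: "0 < 1 / real (Suc n)" by simp
    note I = integral_smoothed[OF int, where \<epsilon> = "1 / real (Suc n)"]
    have "?S n u - ?S n 0 = (LINT w|lborel. g w * smoothed (1 / real (Suc n)) (w - u)
        - g w * smoothed (1 / real (Suc n)) (w - 0))"
      unfolding I(2) by (rule Bochner_Integration.integral_diff[OF I(1) I(1), symmetric])
    also have "\<dots> \<le> (LINT w|lborel. lip * norm u * g w)"
    proof (rule integral_mono)
      show "integrable lborel (\<lambda>w. g w * smoothed (1 / real (Suc n)) (w - u)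
        - g w * smoothed (1 / real (Suc n)) (w - 0))"
        by (rule Bochner_Integration.integrable_diff[OF I(1) I(1)])
      show "integrable lborel (\<lambda>w. lip * norm u * g w)" using int by simp
      fix w
      have "smoothed (1 / real (Suc n)) (w - u) - smoothed (1 / real (Suc n)) w \<le> lip * norm u"
        using smoothed_lipschitz[OF e, of w u] by linarith
      from mult_left_mono[OF this bound(1)[of w]]
      show "g w * smoothed (1 / real (Suc n)) (w - u) - g w * smoothed (1 / real (Suc n)) (w - 0)
          \<le> lip * norm u * g w"
        by (simp add: algebra_simps)
    qed
    finally show ?thesis by simp
  qed
  then have "(LINT y|\<mu>. g (y + u)) \<le> (LINT y|\<mu>. g (y + 0)) + lip * norm u * (LINT x|lborel. g x)"
    by (intro LIMSEQ_le[OF lim tendsto_add[OF lim tendsto_const]]) auto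
  then show ?thesis by simp
qed

lemma translate_open_le:
  assumes U: "open U" "emeasure lborel U < \<infinity>"
  shows "measure \<mu> {y. y + u \<in> U} \<le> measure \<mu> U + lip * norm u * measure lborel U"
proof -
  have [measurable]: "U \<in> sets borel" using U by simp
  \<comment> \<open>The distance to the empty set is 0 by convention, so the approximations below
    would vanish for the whole space. Finite volume excludes that case.\<close>
  have neq: "- U \<noteq> {}"
  proof
    assume "- U = {}"
    then have "U = UNIV" by auto
    with U(2) show False by (simp add: emeasure_lborel_UNIV)
  qed
  \<comment> \<open>Continuous functions below the indicator of \<open>U\<close> that converge to it
    pointwise, since points of an open set have positive distance from the complement.\<close>
  define g where "g n x = min 1 (real n * infdist x (- U))" for n x
  have cont: "continuous_on UNIV (g n)" for n
    unfolding g_def by (intro continuous_intros)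
  have [measurable]: "g n \<in> borel_measurable borel" for n
    using cont by (rule borel_measurable_continuous_onI)
  have g0: "0 \<le> g n x" and gU: "g n x \<le> indicator U x" for n x
    by (auto simp: g_def infdist_nonneg indicator_def)
  have g1: "g n x \<le> 1" for n x by (simp add: g_def)
  have intU: "integrable lborel (indicator U :: 'a \<Rightarrow> real)"
    using U by (simp add: integrable_indicator_iff)
  have int: "integrable lborel (g n)" for n
    by (rule Bochner_Integration.integrable_bound[OF intU]) (use g0 gU in auto)
  have lim: "(\<lambda>n. g n x) \<longlonglongrightarrow> indicator U x" for x
  proof (cases "x \<in> U")
    case True
    then have p: "0 < infdist x (- U)"
      using U(1) neq by (metis Compl_iff closed_Compl in_closed_iff_infdist_zero infdist_nonneg less_eq_real_def)
    obtain N :: nat where N: "1 / infdist x (- U) < real N" using reals_Archimedean2 by blast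
    have "g n x = 1" if "N \<le> n" for n
    proof -
      have "1 / infdist x (- U) \<le> real n" using N that by linarith
      then show ?thesis using p by (simp add: g_def field_simps)
    qed
    then show ?thesis using True
      by (intro tendsto_eventually) (auto simp: eventually_sequentially intro!: exI[of _ N])
  next
    case False
    then show ?thesis by (simp add: g_def)
  qed
  have "(\<lambda>n. LINT y|\<mu>. g n (y + u)) \<longlonglongrightarrow> (LINT y|\<mu>. indicator U (y + u))"
    by (rule integral_dominated_convergence[where w = "\<lambda>_. 1"]) (use lim g0 g1 in auto)
  also have "(LINT y|\<mu>. indicator U (y + u)) = (LINT y|\<mu>. indicator {y. y + u \<in> U} y)"
    by (intro Bochner_Integration.integral_cong) (auto simp: indicator_def)
  also have "\<dots> = measure \<mu> {y. y + u \<in> U}"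
    using sets_eq_imp_space_eq[OF sets_mu] by simp
  finally have "(\<lambda>n. LINT y|\<mu>. g n (y + u)) \<longlonglongrightarrow> measure \<mu> {y. y + u \<in> U}" .
  moreover have "(LINT y|\<mu>. g n (y + u)) \<le> measure \<mu> U + lip * norm u * measure lborel U" for n
  proof -
    have "(LINT y|\<mu>. g n (y + u)) \<le> (LINT y|\<mu>. g n y) + lip * norm u * (LINT x|lborel. g n x)"
      by (rule translate_continuous_le[OF cont g0 g1 int])
    also have "(LINT y|\<mu>. g n y) \<le> (LINT y|\<mu>. indicator U y)"
      by (intro integral_mono integrable_const_bound[where B = 1]) (use g0 g1 gU in auto)
    also have "(LINT x|lborel. g n x) \<le> (LINT x|lborel. indicator U x)"
      by (intro integral_mono int intU gU)
    finally show ?thesis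
      using lip_nonneg sets_eq_imp_space_eq[OF sets_mu]
      by (simp add: mult_left_mono)
  qed
  ultimately show ?thesis by (intro LIMSEQ_le_const2) auto
qed

text \<open>Outer regularity is needed for two measures at once: \<open>U\<close> approximates
  \<open>A\<close> for \<open>\<mu>\<close>, \<open>V\<close> approximates \<open>A\<close> for
  Lebesgue measure, and their intersection is good for both.\<close>

lemma translate_le:
  assumes A[measurable]: "A \<in> sets borel" and fin: "emeasure lborel A < \<infinity>"
  shows "measure \<mu> {y. y + u \<in> A} \<le> measure \<mu> A + lip * norm u * measure lborel A"
proof (rule field_le_epsilon)
  fix e :: real assume "0 < e"
  \<comment> \<open>The approximation costs \<open>d\<close> in the first term and
    \<open>lip * norm u * d\<close> in the second; this choice makes the total
    \<open>e\<close>.\<close>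
  define d where "d = e / (1 + lip * norm u)"
  have pos: "0 < 1 + lip * norm u" using lip_nonneg by (simp add: add_pos_nonneg)
  have d: "0 < d" using \<open>0 < e\<close> pos by (simp add: d_def)
  obtain U where U: "open U" "A \<subseteq> U" "measure \<mu> U < measure \<mu> A + d"
  proof -
    have "emeasure \<mu> A < ennreal (measure \<mu> A + d)"
      using d by (simp add: emeasure_eq_measure ennreal_lessI add_nonneg_pos)
    moreover have "emeasure \<mu> A = (INF U\<in>{U. A \<subseteq> U \<and> open U}. emeasure \<mu> U)"
      by (rule outer_regular[OF sets_mu]) (use A in auto)
    ultimately obtain U where "A \<subseteq> U" "open U" "emeasure \<mu> U < ennreal (measure \<mu> A + d)"
      by (auto simp: INF_less_iff)
    with that show thesis by (auto simp: emeasure_eq_measure ennreal_less_iff)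
  qed
  obtain V where V: "open V" "A \<subseteq> V" "emeasure lborel (V - A) < ennreal d"
    using outer_regular_lborel[OF A d] by auto
  have VA: "emeasure lborel V = emeasure lborel A + emeasure lborel (V - A)"
    using V by (subst plus_emeasure) (auto simp: Un_absorb1)
  then have Vfin: "emeasure lborel V < \<infinity>"
    using fin V(3) by (auto simp: ennreal_add_eq_top less_top[symmetric] top_unique)
  have V': "measure lborel V \<le> measure lborel A + d"
  proof -
    have "measure lborel V = measure lborel A + measure lborel (V - A)"
      using VA fin less_trans[OF V(3) ennreal_less_top] by (simp add: measure_def enn2real_plus)
    moreover have "measure lborel (V - A) \<le> d"
      using V(3) d unfolding measure_def by (intro enn2real_leI) auto
    ultimately show ?thesis by simp
  qed
  have UV: "open (U \<inter> V)" "A \<subseteq> U \<inter> V" "emeasure lborel (U \<inter> V) < \<infinity>"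
    using U V Vfin by (auto intro: le_less_trans[OF emeasure_mono[of "U \<inter> V" V]])
  have [measurable]: "U \<inter> V \<in> sets borel" "U \<in> sets borel" using UV U by auto
  have "measure \<mu> {y. y + u \<in> A} \<le> measure \<mu> {y. y + u \<in> U \<inter> V}"
  proof (rule finite_measure_mono)
    have "{y \<in> space \<mu>. y + u \<in> U \<inter> V} \<in> sets \<mu>" by measurable
    then show "{y. y + u \<in> U \<inter> V} \<in> sets \<mu>"
      using sets_eq_imp_space_eq[OF sets_mu] by simp
  qed (use UV in auto)
  also have "\<dots> \<le> measure \<mu> (U \<inter> V) + lip * norm u * measure lborel (U \<inter> V)"
    by (rule translate_open_le[OF UV(1,3)])
  also have "\<dots> \<le> (measure \<mu> A + d) + lip * norm u * (measure lborel A + d)"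
  proof (intro add_mono mult_left_mono)
    have "measure \<mu> (U \<inter> V) \<le> measure \<mu> U" by (intro finite_measure_mono) (auto simp: sets_mu)
    with U(3) show "measure \<mu> (U \<inter> V) \<le> measure \<mu> A + d" by simp
    have "measure lborel (U \<inter> V) \<le> measure lborel V"
      using Vfin V by (intro measure_mono_fmeasurable) (auto simp: fmeasurable_def)
    with V' show "measure lborel (U \<inter> V) \<le> measure lborel A + d" by simp
  qed (use lip_nonneg in auto)
  also have "\<dots> = measure \<mu> A + lip * norm u * measure lborel A + e"
  proof -
    have "d * (1 + lip * norm u) = e" using pos by (simp add: d_def)
    then show ?thesis by (simp add: algebra_simps)
  qed
  finally show "measure \<mu> {y. y + u \<in> A} \<le> measure \<mu> A + lip * norm u * measure lborel A + e" .
qed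

end

section \<open>Fractional gradient and divergence\<close>

text \<open>One inner-product integral in place of a sum over coordinates, meaningful in any
  Euclidean space; \<open>frac_div_eq_vdiv\<close> links it to \<open>frac_div\<close> on bounded
  Lipschitz fields.\<close>

definition vdiv :: "'a::euclidean_space measure \<Rightarrow> ('a \<Rightarrow> 'a) \<Rightarrow> 'a \<Rightarrow> real" where
  "vdiv \<nu> \<phi> x = (LINT u|\<nu>. (\<phi> (x + u) - \<phi> x) \<bullet> u)"

definition vgrad :: "'a::euclidean_space measure \<Rightarrow> ('a \<Rightarrow> real) \<Rightarrow> 'a \<Rightarrow> 'a" where
  "vgrad \<nu> f x = (LINT u|\<nu>. (f (x + u) - f x) *\<^sub>R u)"

context symmetric_levy_measure
begin

definition first_moment :: real where
  "first_moment = (LINT u|\<nu>. min 1 (norm u) * norm u)"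

lemma integrable_le_moment:
  fixes h :: "'a \<Rightarrow> 'b::{banach, second_countable_topology}"
  assumes h: "h \<in> borel_measurable borel" "\<And>u. norm (h u) \<le> M * (min 1 (norm u) * norm u)"
  shows "integrable \<nu> h" "norm (LINT u|\<nu>. h u) \<le> M * first_moment"
proof -
  have [measurable]: "h \<in> borel_measurable \<nu>"
    using h(1) measurable_cong_sets[OF sets_nu refl] by blast
  have m: "integrable \<nu> (\<lambda>u. M * (min 1 (norm u) * norm u))"
    using moment by simp
  show 1: "integrable \<nu> h"
    by (rule Bochner_Integration.integrable_bound[OF m]) (use h(2) in \<open>auto intro: order_trans[OF _ abs_ge_self]\<close>)
  show "norm (LINT u|\<nu>. h u) \<le> M * first_moment"
    unfolding first_moment_def
    using Bochner_Integration.integral_norm_bound_integral[OF 1 m h(2)] moment by simp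
qed

lemma continuous_integral_nu:
  fixes h :: "'a \<Rightarrow> 'a \<Rightarrow> 'b::{banach, second_countable_topology}"
  assumes cont: "\<And>u. continuous_on UNIV (\<lambda>x. h x u)"
    and h: "\<And>x. h x \<in> borel_measurable borel" "\<And>x u. norm (h x u) \<le> M * (min 1 (norm u) * norm u)"
  shows "continuous_on UNIV (\<lambda>x. LINT u|\<nu>. h x u)"
proof (rule continuous_on_sequentiallyI)
  fix X :: "nat \<Rightarrow> 'a" and a assume X: "X \<longlonglongrightarrow> a"
  have m: "h x \<in> borel_measurable \<nu>" for x
    using h(1) measurable_cong_sets[OF sets_nu refl] by blast
  show "(\<lambda>n. LINT u|\<nu>. h (X n) u) \<longlonglongrightarrow> (LINT u|\<nu>. h a u)"
  proof (rule integral_dominated_convergence[where w = "\<lambda>u. M * (min 1 (norm u) * norm u)"])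
    show "AE u in \<nu>. (\<lambda>n. h (X n) u) \<longlonglongrightarrow> h a u"
      using continuous_on_tendsto_compose[OF cont X] by auto
  qed (use m h(2) moment in auto)
qed

lemma bdd_lip_mult_norm_le:
  assumes "bdd_lip M f"
  shows "norm (f (x + u) - f x) * norm u \<le> M * (min 1 (norm u) * norm u)"
  using mult_right_mono[OF bdd_lipD[OF assms, of x u], of "norm u"] by (simp add: mult.assoc)

lemma
  fixes \<phi> :: "'a \<Rightarrow> 'a"
  assumes "bdd_lip M \<phi>"
  shows vdiv_integrable: "integrable \<nu> (\<lambda>u. (\<phi> (x + u) - \<phi> x) \<bullet> u)"
    and vdiv_bounded: "\<bar>vdiv \<nu> \<phi> x\<bar> \<le> M * first_moment"
    and vdiv_continuous: "continuous_on UNIV (vdiv \<nu> \<phi>)"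
proof -
  note [measurable] = bdd_lip_borel_measurable[OF assms]
  have b: "norm ((\<phi> (x + u) - \<phi> x) \<bullet> u) \<le> M * (min 1 (norm u) * norm u)" for x u
    using order_trans[OF Cauchy_Schwarz_ineq2 bdd_lip_mult_norm_le[OF assms]] by simp
  have m: "(\<lambda>u. (\<phi> (x + u) - \<phi> x) \<bullet> u) \<in> borel_measurable borel" for x by measurable
  show "integrable \<nu> (\<lambda>u. (\<phi> (x + u) - \<phi> x) \<bullet> u)" "\<bar>vdiv \<nu> \<phi> x\<bar> \<le> M * first_moment"
    using integrable_le_moment[OF m b] by (simp_all add: vdiv_def)
  show "continuous_on UNIV (vdiv \<nu> \<phi>)"
    unfolding vdiv_def[abs_def]
    by (rule continuous_integral_nu[OF _ m b])
       (intro continuous_intros continuous_on_compose2[OF bdd_lip_continuous[OF assms]], auto)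
qed

lemma
  fixes f :: "'a \<Rightarrow> real"
  assumes "bdd_lip M f"
  shows vgrad_integrable: "integrable \<nu> (\<lambda>u. (f (x + u) - f x) *\<^sub>R u)"
    and vgrad_bounded: "norm (vgrad \<nu> f x) \<le> M * first_moment"
    and vgrad_continuous: "continuous_on UNIV (vgrad \<nu> f)"
proof -
  note [measurable] = bdd_lip_borel_measurable[OF assms]
  have b: "norm ((f (x + u) - f x) *\<^sub>R u) \<le> M * (min 1 (norm u) * norm u)" for x u
    using bdd_lip_mult_norm_le[OF assms] by simp
  have m: "(\<lambda>u. (f (x + u) - f x) *\<^sub>R u) \<in> borel_measurable borel" for x by measurable
  show "integrable \<nu> (\<lambda>u. (f (x + u) - f x) *\<^sub>R u)" "norm (vgrad \<nu> f x) \<le> M * first_moment"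
    using integrable_le_moment[OF m b] by (simp_all add: vgrad_def)
  show "continuous_on UNIV (vgrad \<nu> f)"
    unfolding vgrad_def[abs_def]
    by (rule continuous_integral_nu[OF _ m b])
       (intro continuous_intros continuous_on_compose2[OF bdd_lip_continuous[OF assms]], auto)
qed

text \<open>The common constant \<open>M\<close> supplies the dominating function, so pointwise
  convergence of the fields is enough.\<close>

lemma vdiv_tendsto:
  fixes \<phi> :: "nat \<Rightarrow> 'a \<Rightarrow> 'a"
  assumes "\<And>n. bdd_lip M (\<phi> n)" "bdd_lip N \<psi>" "\<And>x. (\<lambda>n. \<phi> n x) \<longlonglongrightarrow> \<psi> x"
  shows "(\<lambda>n. vdiv \<nu> (\<phi> n) x) \<longlonglongrightarrow> vdiv \<nu> \<psi> x"
  unfolding vdiv_def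
proof (rule integral_dominated_convergence[where w = "\<lambda>u. M * (min 1 (norm u) * norm u)"])
  show "AE u in \<nu>. (\<lambda>n. (\<phi> n (x + u) - \<phi> n x) \<bullet> u) \<longlonglongrightarrow> (\<psi> (x + u) - \<psi> x) \<bullet> u"
    by (intro AE_I2 tendsto_intros assms)
  show "AE u in \<nu>. norm ((\<phi> n (x + u) - \<phi> n x) \<bullet> u) \<le> M * (min 1 (norm u) * norm u)" for n
    using order_trans[OF Cauchy_Schwarz_ineq2 bdd_lip_mult_norm_le[OF assms(1)]] by auto
qed (use moment vdiv_integrable[OF assms(1)] vdiv_integrable[OF assms(2)] in auto)

lemma integral_nu_uminus:
  fixes J :: "'a \<Rightarrow> real"
  assumes "J \<in> borel_measurable borel"
  shows "(LINT u|\<nu>. J u) = (LINT u|\<nu>. J (- u))"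
proof -
  have "uminus \<in> \<nu> \<rightarrow>\<^sub>M borel" by measurable
  from integral_distr[OF this assms] show ?thesis by (simp add: symmetric)
qed

text \<open>The sign comes from the symmetry of \<open>\<nu>\<close>: moving the increment from \<open>\<phi>\<close> to \<open>f\<close> by a
  translation replaces \<open>u\<close> by \<open>- u\<close>.\<close>

lemma duality:
  fixes f :: "'a \<Rightarrow> real" and \<phi> :: "'a \<Rightarrow> 'a"
  assumes f: "bdd_lip M f" "integrable lborel f" "\<And>x. \<bar>f x\<bar> \<le> 1"
    and \<phi>: "bdd_lip N \<phi>" "integrable lborel \<phi>"
  shows "(LINT x|lborel. f x * vdiv \<nu> \<phi> x) = - (LINT x|lborel. \<phi> x \<bullet> vgrad \<nu> f x)"
proof -
  interpret pair_sigma_finite lborel \<nu> ..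
  note [measurable] = bdd_lip_borel_measurable[OF f(1)] bdd_lip_borel_measurable[OF \<phi>(1)]
  let ?H1 = "\<lambda>x u. f x * ((\<phi> (x + u) - \<phi> x) \<bullet> u)"
  let ?H2 = "\<lambda>x u. (f (x + u) - f x) * (\<phi> x \<bullet> u)"
  have i1: "integrable (lborel \<Otimes>\<^sub>M \<nu>) (case_prod ?H1)"
  proof (rule integrable_pair_dominated[where a = "\<lambda>x. \<bar>f x\<bar>" and b = "\<lambda>u. N * (min 1 (norm u) * norm u)"])
    show "norm (case_prod ?H1 (x, u)) \<le> \<bar>f x\<bar> * (N * (min 1 (norm u) * norm u))" for x u
      using order_trans[OF Cauchy_Schwarz_ineq2 bdd_lip_mult_norm_le[OF \<phi>(1), of x u]]
      by (auto simp: abs_mult intro!: mult_left_mono)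
    show "sigma_finite_measure \<nu>" by unfold_locales
    show "integrable lborel (\<lambda>x. \<bar>f x\<bar>)" using f(2) by (rule integrable_abs)
  qed (use moment in auto)
  have i2: "integrable (lborel \<Otimes>\<^sub>M \<nu>) (case_prod ?H2)"
  proof (rule integrable_pair_dominated[where a = "\<lambda>x. norm (\<phi> x)" and b = "\<lambda>u. M * (min 1 (norm u) * norm u)"])
    fix x u
    have "norm (case_prod ?H2 (x, u)) \<le> \<bar>f (x + u) - f x\<bar> * (norm (\<phi> x) * norm u)"
      by (auto simp: abs_mult intro!: mult_left_mono Cauchy_Schwarz_ineq2)
    also have "\<dots> = norm (\<phi> x) * (norm (f (x + u) - f x) * norm u)"
      by (simp add: mult_ac)
    also have "\<dots> \<le> norm (\<phi> x) * (M * (min 1 (norm u) * norm u))"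
      by (intro mult_left_mono bdd_lip_mult_norm_le[OF f(1)]) auto
    finally show "norm (case_prod ?H2 (x, u)) \<le> norm (\<phi> x) * (M * (min 1 (norm u) * norm u))" .
  next
    show "sigma_finite_measure \<nu>" by unfold_locales
    show "integrable lborel (\<lambda>x. norm (\<phi> x))" using \<phi>(2) by (rule integrable_norm)
  qed (use moment in auto)
  \<comment> \<open>The increment is split only after \<open>u\<close> has been fixed: the separate
    terms are integrable in \<open>x\<close>, but near \<open>u = 0\<close> they lack the
    cancellation that makes the increment integrable against \<open>\<nu>\<close>.\<close>
  have translate: "(LINT x|lborel. ?H1 x (- u)) = - (LINT x|lborel. ?H2 x u)" for u
  proof -
    have b: "norm (f x * (\<phi> y \<bullet> u)) \<le> norm (norm u * norm (\<phi> y))" for x y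
    proof -
      have "norm (f x * (\<phi> y \<bullet> u)) \<le> 1 * (norm (\<phi> y) * norm u)"
        unfolding abs_mult real_norm_def by (intro mult_mono f Cauchy_Schwarz_ineq2) auto
      then show ?thesis by (simp add: mult.commute)
    qed
    have p: "integrable lborel (\<lambda>x. norm u * norm (\<phi> x))"
      using \<phi>(2) by simp
    then have pm: "integrable lborel (\<lambda>x. norm u * norm (\<phi> (- u + x)))"
      by (subst lborel_integrable_shift[where f = "\<lambda>x. norm u * norm (\<phi> x)"]) auto
    have j1: "integrable lborel (\<lambda>x. f x * (\<phi> (- u + x) \<bullet> u))"
      by (rule Bochner_Integration.integrable_bound[OF pm]) (use b in auto)
    have j2: "integrable lborel (\<lambda>x. f x * (\<phi> x \<bullet> u))"
      by (rule Bochner_Integration.integrable_bound[OF p]) (use b in auto)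
    have j3: "integrable lborel (\<lambda>x. f (u + x) * (\<phi> x \<bullet> u))"
      by (rule Bochner_Integration.integrable_bound[OF p]) (use b in auto)
    have "(LINT x|lborel. ?H1 x (- u)) = (LINT x|lborel. f x * (\<phi> x \<bullet> u) - f x * (\<phi> (- u + x) \<bullet> u))"
      by (intro Bochner_Integration.integral_cong) (auto simp: algebra_simps)
    also have "\<dots> = (LINT x|lborel. f x * (\<phi> x \<bullet> u)) - (LINT x|lborel. f x * (\<phi> (- u + x) \<bullet> u))"
      by (rule Bochner_Integration.integral_diff[OF j2 j1])
    also have "(LINT x|lborel. f x * (\<phi> (- u + x) \<bullet> u)) = (LINT x|lborel. f (u + x) * (\<phi> x \<bullet> u))"
      by (subst lborel_integral_shift[where f = "\<lambda>x. f x * (\<phi> (- u + x) \<bullet> u)" and t = u, symmetric])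
         (simp_all add: algebra_simps)
    also have "(LINT x|lborel. f x * (\<phi> x \<bullet> u)) - (LINT x|lborel. f (u + x) * (\<phi> x \<bullet> u))
        = (LINT x|lborel. - ?H2 x u)"
      by (subst Bochner_Integration.integral_diff[OF j2 j3, symmetric])
         (intro Bochner_Integration.integral_cong, auto simp: algebra_simps)
    finally show ?thesis by simp
  qed
  have "(LINT x|lborel. f x * vdiv \<nu> \<phi> x) = (LINT x|lborel. (LINT u|\<nu>. ?H1 x u))"
    by (simp add: vdiv_def)
  also have "\<dots> = (LINT u|\<nu>. (LINT x|lborel. ?H1 x u))"
    by (rule Fubini_integral[OF i1, symmetric])
  also have "\<dots> = (LINT u|\<nu>. (LINT x|lborel. ?H1 x (- u)))"
    by (rule integral_nu_uminus) measurable
  also have "\<dots> = - (LINT u|\<nu>. (LINT x|lborel. ?H2 x u))"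
    by (simp only: translate integral_minus)
  also have "(LINT u|\<nu>. (LINT x|lborel. ?H2 x u)) = (LINT x|lborel. (LINT u|\<nu>. ?H2 x u))"
    by (rule Fubini_integral[OF i2])
  also have "\<dots> = (LINT x|lborel. \<phi> x \<bullet> vgrad \<nu> f x)"
  proof (rule Bochner_Integration.integral_cong[OF refl])
    fix x
    have "(LINT u|\<nu>. ?H2 x u) = (LINT u|\<nu>. \<phi> x \<bullet> ((f (x + u) - f x) *\<^sub>R u))"
      by simp
    also have "\<dots> = \<phi> x \<bullet> vgrad \<nu> f x"
      unfolding vgrad_def by (rule integral_inner_right) (rule vgrad_integrable[OF f(1)])
    finally show "(LINT u|\<nu>. ?H2 x u) = \<phi> x \<bullet> vgrad \<nu> f x" .
  qed
  finally show ?thesis .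
qed

end

lemma frac_gradient_eq_vgrad: "frac_gradient \<nu> f x = vgrad \<nu> f x"
  by (simp add: frac_gradient_def vgrad_def)

text \<open>Each scalar component inherits the constant \<open>M\<close>, so every coordinate
  integral converges and the finite sum passes inside. For divergent integrals the default value
  could make the two sides differ.\<close>

lemma frac_div_eq_vdiv:
  fixes \<phi> :: "real^'n \<Rightarrow> real^'n"
  assumes "symmetric_levy_measure \<nu>" "bdd_lip M \<phi>"
  shows "frac_div \<nu> \<phi> x = vdiv \<nu> \<phi> x"
proof -
  interpret symmetric_levy_measure \<nu> by fact
  have "bdd_lip M (\<lambda>z. \<phi> z $ k)" for k
    unfolding bdd_lip_def
  proof safe
    fix x u
    have "norm (\<phi> (x + u) $ k - \<phi> x $ k) \<le> norm (\<phi> (x + u) - \<phi> x)"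
      using component_le_norm_cart[of "\<phi> (x + u) - \<phi> x" k] by simp
    also have "\<dots> \<le> M * min 1 (norm u)" by (rule bdd_lipD[OF assms(2)])
    finally show "norm (\<phi> (x + u) $ k - \<phi> x $ k) \<le> M * min 1 (norm u)" .
  qed
  note int = vgrad_integrable[OF this]
  have comp: "frac_gradient \<nu> (\<lambda>z. \<phi> z $ k) x $ k = (LINT u|\<nu>. (\<phi> (x + u) $ k - \<phi> x $ k) * u $ k)"
    and intk: "integrable \<nu> (\<lambda>u. (\<phi> (x + u) $ k - \<phi> x $ k) * u $ k)" for k
    using integral_bounded_linear[OF bounded_linear_vec_nth int[of x k], of k]
      integrable_bounded_linear[OF bounded_linear_vec_nth int[of x k], of k]
    by (simp_all add: frac_gradient_def)
  show ?thesis
    unfolding frac_div_def comp vdiv_def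
    by (subst Bochner_Integration.integral_sum[symmetric, OF intk])
       (simp add: inner_vec_def)
qed

text \<open>A second-order Taylor bound uniform in the base point, since the directional derivatives
  are again test functions and hence Lipschitz. The uniformity lets it be integrated against
  \<open>\<mu>\<close>.\<close>

lemma test_fn_remainder:
  fixes \<phi> :: "'a::euclidean_space \<Rightarrow> 'b::euclidean_space"
  assumes "test_fn \<phi>"
  obtains C where "0 \<le> C"
    "\<And>z w. norm (\<phi> (z + w) - \<phi> z - frechet_derivative \<phi> (at z) w) \<le> C * norm w * norm w"
proof -
  let ?D = "\<lambda>x. frechet_derivative \<phi> (at x)"
  note D = test_fn_has_derivative[OF assms]
  have "\<exists>M. bdd_lip M (\<lambda>x. ?D x b)" for b
    using test_fn_bdd_lip[OF test_fn_frechet_derivative[OF assms]] by metis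
  then obtain M where M: "\<And>b. bdd_lip (M b) (\<lambda>x. ?D x b)" by metis
  let ?C = "\<Sum>b\<in>Basis. M b"
  have C: "0 \<le> ?C" by (intro sum_nonneg bdd_lip_nonneg[OF M])
  have on: "onorm (\<lambda>v. ?D y v - ?D z v) \<le> ?C * norm (y - z)" for y z
  proof (rule onorm_le)
    fix v
    have bdd_lip: "bounded_linear (\<lambda>v. ?D y v - ?D z v)"
      by (intro bounded_linear_sub has_derivative_bounded_linear[OF D])
    have "norm (?D y v - ?D z v) \<le> (\<Sum>b\<in>Basis. norm (?D y b - ?D z b)) * norm v"
      by (rule linear_norm_le_sum_Basis[OF bdd_lip])
    also have "\<dots> \<le> (\<Sum>b\<in>Basis. M b * norm (y - z)) * norm v"
    proof (intro mult_right_mono sum_mono)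
      fix b :: 'a
      have "norm (?D (z + (y - z)) b - ?D z b) \<le> M b * min 1 (norm (y - z))"
        by (rule bdd_lipD[OF M])
      also have "\<dots> \<le> M b * norm (y - z)"
        by (intro mult_left_mono bdd_lip_nonneg[OF M]) auto
      finally show "norm (?D y b - ?D z b) \<le> M b * norm (y - z)" by simp
    qed auto
    finally show "norm (?D y v - ?D z v) \<le> ?C * norm (y - z) * norm v"
      by (simp add: sum_distrib_right)
  qed
  have "norm (\<phi> (z + w) - \<phi> z - ?D z w) \<le> ?C * norm w * norm w" for z w
  proof -
    have "norm (\<phi> (z + w) - \<phi> z - ?D z ((z + w) - z)) \<le> norm ((z + w) - z) * (?C * norm w)"
    proof (rule differentiable_bound_linearization[where S = "closed_segment z (z + w)" and f' = ?D])
      show "z + t *\<^sub>R (z + w - z) \<in> closed_segment z (z + w)" if "t \<in> {0..1}" for t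
        using that by (auto simp: closed_segment_def algebra_simps intro!: exI[of _ t])
      show "onorm (?D x - ?D z) \<le> ?C * norm w" if "x \<in> closed_segment z (z + w)" for x
      proof -
        have "norm (x - z) \<le> norm w" using segment_bound(1)[OF that] by simp
        then have "?C * norm (x - z) \<le> ?C * norm w" using C by (rule mult_left_mono)
        with on[of x z] show ?thesis by (simp add: fun_diff_def)
      qed
    qed (auto intro: has_derivative_at_withinI[OF D])
    then show ?thesis by (simp add: mult_ac)
  qed
  then show thesis using that C by blast
qed

section \<open>Averages of translates\<close>

text \<open>For \<open>s = t powr (1 / \<alpha>)\<close> this is \<open>P'\<^sub>t\<close>, acting
  on scalar functions and on fields alike.\<close>

definition avg :: "'a::euclidean_space measure \<Rightarrow> real \<Rightarrow> ('a \<Rightarrow> 'b::euclidean_space) \<Rightarrow> 'a \<Rightarrow> 'b" where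
  "avg \<mu> s \<phi> x = (LINT y|\<mu>. \<phi> (x - s *\<^sub>R y))"

context borel_prob
begin

lemma integrable_bounded_cont:
  fixes \<phi> :: "'a \<Rightarrow> 'b::euclidean_space"
  assumes "continuous_on UNIV \<phi>" "\<And>x. norm (\<phi> x) \<le> A"
  shows "integrable \<mu> (\<lambda>y. \<phi> (x - s *\<^sub>R y))"
proof -
  have [measurable]: "\<phi> \<in> borel_measurable borel"
    using assms(1) by (rule borel_measurable_continuous_onI)
  show ?thesis by (rule integrable_const_bound[where B = A]) (use assms(2) in auto)
qed

lemma norm_avg_le:
  fixes \<phi> :: "'a \<Rightarrow> 'b::euclidean_space"
  assumes "continuous_on UNIV \<phi>" "\<And>x. norm (\<phi> x) \<le> A"
  shows "norm (avg \<mu> s \<phi> x) \<le> A"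
proof -
  have "norm (avg \<mu> s \<phi> x) \<le> (LINT y|\<mu>. A)"
    unfolding avg_def
    by (rule Bochner_Integration.integral_norm_bound_integral[OF integrable_bounded_cont[OF assms]])
       (use assms(2) in auto)
  then show ?thesis by (simp add: prob_space)
qed

lemma bdd_lip_avg:
  fixes \<phi> :: "'a \<Rightarrow> 'b::euclidean_space"
  assumes "bdd_lip M \<phi>" "\<And>x. norm (\<phi> x) \<le> A"
  shows "bdd_lip M (avg \<mu> s \<phi>)"
  unfolding bdd_lip_def
proof safe
  fix x u
  note int = integrable_bounded_cont[OF bdd_lip_continuous[OF assms(1)] assms(2)]
  have "norm (avg \<mu> s \<phi> (x + u) - avg \<mu> s \<phi> x)
      = norm (LINT y|\<mu>. \<phi> (x + u - s *\<^sub>R y) - \<phi> (x - s *\<^sub>R y))"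
    unfolding avg_def by (simp add: Bochner_Integration.integral_diff[OF int int])
  also have "\<dots> \<le> (LINT y|\<mu>. M * min 1 (norm u))"
  proof (rule Bochner_Integration.integral_norm_bound_integral)
    show "norm (\<phi> (x + u - s *\<^sub>R y) - \<phi> (x - s *\<^sub>R y)) \<le> M * min 1 (norm u)" for y
      using bdd_lipD[OF assms(1), of "x - s *\<^sub>R y" u] by (simp add: algebra_simps)
  qed (auto intro: Bochner_Integration.integrable_diff int)
  finally show "norm (avg \<mu> s \<phi> (x + u) - avg \<mu> s \<phi> x) \<le> M * min 1 (norm u)"
    by (simp add: prob_space)
qed

text \<open>Differentiation under the integral: averaging the uniform Taylor remainder over the
  probability \<open>\<mu>\<close> leaves the same quadratic bound.\<close>

lemma avg_has_derivative:
  fixes \<phi> :: "'a \<Rightarrow> 'b::euclidean_space"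
  assumes \<phi>: "test_fn \<phi>"
  shows "(avg \<mu> s \<phi> has_derivative (\<lambda>v. avg \<mu> s (\<lambda>x. frechet_derivative \<phi> (at x) v) x)) (at x)"
proof -
  let ?D = "\<lambda>x. frechet_derivative \<phi> (at x)"
  have int: "integrable \<mu> (\<lambda>y. f (x - s *\<^sub>R y))" if "test_fn f" for f :: "'a \<Rightarrow> 'b" and x
    using test_fn_bounded[OF that] integrable_bounded_cont[OF test_fn_continuous[OF that]] by metis
  note intD = int[OF test_fn_frechet_derivative[OF \<phi>]]
  have lin: "linear (?D x)" for x
    using has_derivative_linear[OF test_fn_has_derivative[OF \<phi>]] .
  obtain C where C: "0 \<le> C"
    "\<And>z w. norm (\<phi> (z + w) - \<phi> z - ?D z w) \<le> C * norm w * norm w"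
    using test_fn_remainder[OF \<phi>] by metis
  have rem: "norm (avg \<mu> s \<phi> (x + w) - avg \<mu> s \<phi> x - avg \<mu> s (\<lambda>x. ?D x w) x) \<le> C * norm w * norm w" for w
  proof -
    have "avg \<mu> s \<phi> (x + w) - avg \<mu> s \<phi> x - avg \<mu> s (\<lambda>x. ?D x w) x
      = (LINT y|\<mu>. \<phi> (x + w - s *\<^sub>R y) - \<phi> (x - s *\<^sub>R y) - ?D (x - s *\<^sub>R y) w)"
      unfolding avg_def using int[OF \<phi>] intD by simp
    also have "norm \<dots> \<le> (LINT y|\<mu>. C * norm w * norm w)"
    proof (rule Bochner_Integration.integral_norm_bound_integral)
      show "norm (\<phi> (x + w - s *\<^sub>R y) - \<phi> (x - s *\<^sub>R y) - ?D (x - s *\<^sub>R y) w) \<le> C * norm w * norm w" for y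
        using C(2)[of "x - s *\<^sub>R y" w] by (simp add: algebra_simps)
    qed (use int[OF \<phi>] intD in auto)
    finally show ?thesis by (simp add: prob_space)
  qed
  have "linear (\<lambda>v. avg \<mu> s (\<lambda>x. ?D x v) x)"
    by (rule linearI) (use intD in \<open>simp_all add: avg_def linear_add[OF lin] linear_scale[OF lin]\<close>)
  then have "bounded_linear (\<lambda>v. avg \<mu> s (\<lambda>x. ?D x v) x)"
    by (simp add: linear_conv_bounded_linear)
  moreover have "((\<lambda>w. norm (avg \<mu> s \<phi> (x + w) - avg \<mu> s \<phi> x - avg \<mu> s (\<lambda>x. ?D x w) x) / norm w) \<longlongrightarrow> 0) (at 0)"
  proof (rule tendsto_sandwich[where f = "\<lambda>_. 0" and h = "\<lambda>w. C * norm w"])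
    show "\<forall>\<^sub>F w in at 0. norm (avg \<mu> s \<phi> (x + w) - avg \<mu> s \<phi> x - avg \<mu> s (\<lambda>x. ?D x w) x) / norm w \<le> C * norm w"
      using rem by (auto simp: eventually_at_filter divide_simps)
    show "((\<lambda>w::'a. C * norm w) \<longlongrightarrow> 0) (at 0)"
      by (auto intro!: tendsto_eq_intros)
  qed auto
  ultimately show ?thesis by (simp add: has_derivative_at)
qed

text \<open>The derivative of an average is the average of a directional derivative. The induction
  runs over test functions \<phi>, a class closed under such derivatives, while the averages need
  not have bounded support.\<close>

lemma cont_diff_avg:
  fixes \<phi> :: "'a \<Rightarrow> 'b::euclidean_space"
  assumes "test_fn \<phi>"
  shows "cont_diff k (avg \<mu> s \<phi>)"
  using assms
proof (induction k arbitrary: \<phi>)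
  case 0
  obtain M A where "bdd_lip M \<phi>" "\<And>x. norm (\<phi> x) \<le> A"
    using test_fn_bdd_lip[OF 0] test_fn_bounded[OF 0] by metis
  then have "continuous_on UNIV (avg \<mu> s \<phi>)" by (intro bdd_lip_continuous[OF bdd_lip_avg])
  then show ?case by simp
next
  case (Suc k)
  show ?case
    by (rule cont_diff_SucI[OF avg_has_derivative[OF Suc.prems]])
       (use Suc.IH[OF test_fn_frechet_derivative[OF Suc.prems]] in simp)
qed

text \<open>For fixed \<open>y\<close> a translation of \<open>x\<close> moves the shift from
  \<open>E\<close> to \<open>h\<close>, and Fubini does the rest. With \<open>h\<close> constantly 1
  the first part says that \<open>P\<^sub>t\<close> of the indicator is integrable.\<close>

lemma
  fixes h :: "'a \<Rightarrow> real"
  assumes E[measurable]: "E \<in> sets borel" and fin: "emeasure lborel E < \<infinity>"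
    and h: "continuous_on UNIV h" "\<And>x. \<bar>h x\<bar> \<le> C"
  shows integrable_translate_mult:
      "integrable lborel (\<lambda>x. (LINT y|\<mu>. indicator E (x + s *\<^sub>R y)) * h x)" (is ?int)
    and integral_translate_mult:
      "(LINT x|lborel. (LINT y|\<mu>. indicator E (x + s *\<^sub>R y)) * h x) =
       (LINT x|lborel. indicator E x * avg \<mu> s h x)" (is "?lhs = ?rhs")
proof -
  interpret pair_sigma_finite \<mu> lborel ..
  have [measurable]: "h \<in> borel_measurable borel" using h(1) by (rule borel_measurable_continuous_onI)
  have indE: "integrable lborel (indicator E :: 'a \<Rightarrow> real)"
    using fin by (simp add: integrable_indicator_iff)
  let ?F = "\<lambda>y x. indicator E x * h (x - s *\<^sub>R y)"
  have i2: "integrable (\<mu> \<Otimes>\<^sub>M lborel) (case_prod ?F)"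
    by (rule integrable_pair_dominated[where a = "\<lambda>_. C" and b = "indicator E"])
       (use h indE in \<open>auto simp: abs_mult indicator_def lborel.sigma_finite_measure_axioms\<close>)
  have shift: "(LINT x|lborel. indicator E (x + s *\<^sub>R y) * h x) = (LINT x|lborel. ?F y x)" for y
    using lborel_integral_shift[of "?F y" "s *\<^sub>R y"] by (simp add: add.commute)
  \<comment> \<open>No product bound is at hand, because the translated set moves with
    \<open>y\<close>. Instead the inner integrals are bounded by \<open>C\<close> times the volume
    of \<open>E\<close>, uniformly in \<open>y\<close>, by translation invariance.\<close>
  have i1: "integrable (\<mu> \<Otimes>\<^sub>M lborel) (\<lambda>(y, x). indicator E (x + s *\<^sub>R y) * h x)"
  proof (rule Fubini_integrable)
    show "integrable \<mu> (\<lambda>y. LINT x|lborel. norm (case (y, x) of (y, x) \<Rightarrow> indicator E (x + s *\<^sub>R y) * h x))"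
    proof (rule integrable_const_bound[where B = "C * measure lborel E"])
      show "AE y in \<mu>. norm (LINT x|lborel. norm (case (y, x) of (y, x) \<Rightarrow> indicator E (x + s *\<^sub>R y) * h x))
          \<le> C * measure lborel E"
      proof (rule AE_I2)
        fix y
        have s: "(LINT x|lborel. indicator E (s *\<^sub>R y + x)) = measure lborel E"
          using lborel_integral_shift[of "indicator E :: 'a \<Rightarrow> real" "s *\<^sub>R y"] by simp
        have si: "integrable lborel (\<lambda>x. indicator E (s *\<^sub>R y + x) :: real)"
          using lborel_integrable_shift[of "indicator E :: 'a \<Rightarrow> real" "s *\<^sub>R y"] indE by simp
        have "norm (LINT x|lborel. norm (indicator E (x + s *\<^sub>R y) * h x))
            \<le> (LINT x|lborel. C * indicator E (s *\<^sub>R y + x))"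
        proof (rule Bochner_Integration.integral_norm_bound_integral)
          show "integrable lborel (\<lambda>x. C * indicator E (s *\<^sub>R y + x))" using si by simp
          then show "integrable lborel (\<lambda>x. norm (indicator E (x + s *\<^sub>R y) * h x))"
            by (rule Bochner_Integration.integrable_bound)
               (use h(2) in \<open>auto simp: indicator_def add.commute intro: order_trans[OF _ abs_ge_self]\<close>)
        qed (use h(2) in \<open>auto simp: abs_mult indicator_def add.commute\<close>)
        then show "norm (LINT x|lborel. norm (case (y, x) of (y, x) \<Rightarrow> indicator E (x + s *\<^sub>R y) * h x))
          \<le> C * measure lborel E" by (simp add: s)
      qed
    qed measurable
    show "AE y in \<mu>. integrable lborel (\<lambda>x. case (y, x) of (y, x) \<Rightarrow> indicator E (x + s *\<^sub>R y) * h x)"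
    proof (rule AE_I2)
      fix y
      have "integrable lborel (\<lambda>x. ?F y x)"
        by (rule Bochner_Integration.integrable_bound[of _ "\<lambda>x. C * indicator E x"])
           (use h(2) indE in \<open>auto intro: order_trans[OF _ abs_ge_self] split: split_indicator\<close>)
      then show "integrable lborel (\<lambda>x. case (y, x) of (y, x) \<Rightarrow> indicator E (x + s *\<^sub>R y) * h x)"
        using lborel_integrable_shift[of "?F y" "s *\<^sub>R y"] by (simp add: add.commute)
    qed
  qed measurable
  show ?int using integrable_snd[OF i1] by simp
  have "?lhs
      = (LINT x|lborel. (LINT y|\<mu>. indicator E (x + s *\<^sub>R y) * h x))"
    by simp
  also have "\<dots> = (LINT y|\<mu>. (LINT x|lborel. indicator E (x + s *\<^sub>R y) * h x))"
    by (rule Fubini_integral[OF i1])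
  also have "\<dots> = (LINT y|\<mu>. (LINT x|lborel. ?F y x))"
    by (simp only: shift)
  also have "\<dots> = (LINT x|lborel. (LINT y|\<mu>. ?F y x))"
    by (rule Fubini_integral[OF i2, symmetric])
  also have "\<dots> = (LINT x|lborel. indicator E x * avg \<mu> s h x)"
    by (simp add: avg_def)
  finally show "?lhs = ?rhs" .
qed

text \<open>The divergence commutes with translations, hence with their averages; the product bound
  for Fubini is constant in \<open>y\<close> because the Lipschitz bound holds at every base
  point.\<close>

lemma vdiv_avg:
  fixes \<phi> :: "'a \<Rightarrow> 'a"
  assumes "symmetric_levy_measure \<nu>" and \<phi>: "bdd_lip M \<phi>" "\<And>x. norm (\<phi> x) \<le> A"
  shows "vdiv \<nu> (avg \<mu> s \<phi>) x = avg \<mu> s (vdiv \<nu> \<phi>) x"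
proof -
  interpret \<nu>: symmetric_levy_measure \<nu> by fact
  interpret pair_sigma_finite \<mu> \<nu> ..
  note [measurable] = bdd_lip_borel_measurable[OF \<phi>(1)]
  let ?F = "\<lambda>y u. (\<phi> (x - s *\<^sub>R y + u) - \<phi> (x - s *\<^sub>R y)) \<bullet> u"
  note int = integrable_bounded_cont[OF bdd_lip_continuous[OF \<phi>(1)] \<phi>(2)]
  have i: "integrable (\<mu> \<Otimes>\<^sub>M \<nu>) (case_prod ?F)"
    by (rule integrable_pair_dominated[where a = "\<lambda>_. 1" and b = "\<lambda>u. M * (min 1 (norm u) * norm u)"])
       (use \<nu>.moment order_trans[OF Cauchy_Schwarz_ineq2 \<nu>.bdd_lip_mult_norm_le[OF \<phi>(1)]]
         in \<open>auto intro: \<nu>.sigma_finite_measure_axioms\<close>)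
  have "vdiv \<nu> (avg \<mu> s \<phi>) x = (LINT u|\<nu>. (LINT y|\<mu>. ?F y u))"
    unfolding vdiv_def
  proof (rule Bochner_Integration.integral_cong[OF refl])
    fix u
    have "(avg \<mu> s \<phi> (x + u) - avg \<mu> s \<phi> x) \<bullet> u
        = (LINT y|\<mu>. \<phi> (x + u - s *\<^sub>R y) - \<phi> (x - s *\<^sub>R y)) \<bullet> u"
      unfolding avg_def by (simp add: Bochner_Integration.integral_diff[OF int int])
    also have "\<dots> = (LINT y|\<mu>. (\<phi> (x + u - s *\<^sub>R y) - \<phi> (x - s *\<^sub>R y)) \<bullet> u)"
      by (rule integral_inner_left[symmetric]) (intro Bochner_Integration.integrable_diff int)
    finally show "(avg \<mu> s \<phi> (x + u) - avg \<mu> s \<phi> x) \<bullet> u = (LINT y|\<mu>. ?F y u)"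
      by (simp add: algebra_simps)
  qed
  also have "\<dots> = (LINT y|\<mu>. (LINT u|\<nu>. ?F y u))"
    by (rule Fubini_integral[OF i])
  finally show ?thesis by (simp add: avg_def vdiv_def)
qed

end

section \<open>Decay of the characteristic function of a stable law\<close>

lemma integrable_exp_neg_abs:
  fixes a :: real
  assumes "0 < a"
  shows "integrable lborel (\<lambda>x. exp (- a * \<bar>x\<bar>))"
proof -
  let ?f = "\<lambda>x. exp (- a * x) * indicator {0..} x :: real"
  have "(\<integral>\<^sup>+x. ennreal (exp (- a * x)) * indicator {0..} x \<partial>lborel) = ennreal (exp (- a * 0) / a)"
    by (rule nn_integral_has_integral_lebesgue'[OF _ has_integral_exp_minus_to_infinity]) (use assms in auto)
  moreover have "ennreal (norm (?f x)) = ennreal (exp (- a * x)) * indicator {0..} x" for x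
    by (auto split: split_indicator)
  ultimately have f: "integrable lborel ?f"
    by (intro integrableI_bounded) auto
  then have "integrable lborel (\<lambda>x. ?f (0 + (- 1) * x))"
    by (rule lborel_integrable_real_affine) simp
  with f have "integrable lborel (\<lambda>x. ?f x + ?f (0 + (- 1) * x))"
    by (rule Bochner_Integration.integrable_add)
  then show ?thesis
    by (rule Bochner_Integration.integrable_bound) (auto split: split_indicator)
qed

lemma integrable_exp_neg_norm:
  fixes c :: real
  assumes "0 < c"
  shows "integrable lborel (\<lambda>x::'a::euclidean_space. exp (- c * norm x))"
proof -
  \<comment> \<open>Each coordinate is at most the norm, so dividing \<open>c\<close> by the
    dimension keeps the weighted sum of coordinates below \<open>c * norm x\<close> and bounds the
    exponential by a product.\<close>
  let ?a = "c / real DIM('a)"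
  have "integrable lborel (\<lambda>x::'a. \<Prod>b\<in>Basis. exp (- ?a * \<bar>x \<bullet> b\<bar>))"
    by (intro integrable_lborel_prod integrable_exp_neg_abs) (use assms in simp)
  then show ?thesis
  proof (rule Bochner_Integration.integrable_bound)
    have "exp (- c * norm x) \<le> (\<Prod>b\<in>Basis. exp (- ?a * \<bar>x \<bullet> b\<bar>))" for x :: 'a
    proof -
      have "(\<Sum>b\<in>Basis. \<bar>x \<bullet> b\<bar>) \<le> (\<Sum>b\<in>(Basis::'a set). norm x)"
        by (intro sum_mono Basis_le_norm)
      then have "?a * (\<Sum>b\<in>Basis. \<bar>x \<bullet> b\<bar>) \<le> ?a * (real DIM('a) * norm x)"
        using assms by (intro mult_left_mono) auto
      then have "- c * norm x \<le> (\<Sum>b\<in>Basis. - ?a * \<bar>x \<bullet> b\<bar>)"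
        by (simp add: sum_distrib_left sum_negf)
      then show ?thesis by (simp add: exp_sum[symmetric])
    qed
    then show "AE x in lborel. norm (exp (- c * norm x)) \<le> norm (\<Prod>b\<in>(Basis::'a set). exp (- ?a * \<bar>x \<bullet> b\<bar>))"
      by (intro AE_I2) (auto simp: abs_prod)
  qed measurable
qed

text \<open>Since x^\<alpha> is at least x - 1, the exponential decays at rate \<open>c\<close>;
  half of that rate absorbs the factor \<open>x\<close>, and the shift by 1 leaves the constant
  \<open>exp c\<close>.\<close>

lemma norm_mult_exp_powr_le:
  fixes x c \<alpha> :: real
  assumes "0 \<le> x" "0 < c" "1 < \<alpha>"
  shows "x * exp (- (c * x powr \<alpha>)) \<le> 2 / c * exp c * exp (- (c / 2) * x)"
proof -
  have "x - 1 \<le> x powr \<alpha>"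
  proof (cases "1 \<le> x")
    case True
    then have "x powr 1 \<le> x powr \<alpha>" using assms by (intro powr_mono) auto
    with True show ?thesis by simp
  next
    case False
    then show ?thesis by (smt (verit) powr_ge_zero)
  qed
  then have 1: "c * (x - 1) \<le> c * x powr \<alpha>" using assms by (intro mult_left_mono) auto
  have "c / 2 * x \<le> exp (c / 2 * x)" using exp_ge_add_one_self[of "c / 2 * x"] by linarith
  then have 2: "x \<le> 2 / c * exp (c / 2 * x)" using assms by (simp add: field_simps)
  have "x * exp (- (c * x powr \<alpha>)) \<le> (2 / c * exp (c / 2 * x)) * exp (- (c * (x - 1)))"
    using 1 2 assms by (intro mult_mono) auto
  also have "\<dots> = 2 / c * exp c * exp (- (c / 2) * x)"
    by (simp add: algebra_simps flip: exp_add)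
  finally show ?thesis .
qed

text \<open>The exponent is homogeneous of degree \<alpha>, so its infimum over the unit sphere
  controls it everywhere.\<close>

lemma nondegenerate_lower_bound:
  fixes \<sigma> :: "(real^'n) measure"
  assumes "nondegenerate \<alpha> \<sigma>" "0 < \<alpha>"
  obtains c where "0 < c"
    "\<And>\<xi>. c * norm \<xi> powr \<alpha> \<le> (LINT y|spectral_measure \<alpha> \<sigma>. \<bar>y \<bullet> \<xi>\<bar> powr \<alpha>)"
proof -
  let ?\<psi> = "\<lambda>\<xi>. LINT y|spectral_measure \<alpha> \<sigma>. \<bar>y \<bullet> \<xi>\<bar> powr \<alpha>"
  define c where "c = (INF \<xi>\<in>sphere 0 1. ?\<psi> \<xi>)"
  have "0 < c" using assms(1) by (simp add: nondegenerate_def c_def inner_commute)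
  moreover have "c * norm \<xi> powr \<alpha> \<le> ?\<psi> \<xi>" for \<xi>
  proof (cases "\<xi> = 0")
    case False
    have "c \<le> ?\<psi> (sgn \<xi>)"
      unfolding c_def using False
      by (intro cINF_lower bdd_belowI[of _ 0]) (auto simp: norm_sgn)
    then have "norm \<xi> powr \<alpha> * c \<le> norm \<xi> powr \<alpha> * ?\<psi> (sgn \<xi>)"
      by (intro mult_left_mono) auto
    also have "\<dots> = (LINT y|spectral_measure \<alpha> \<sigma>. norm \<xi> powr \<alpha> * \<bar>y \<bullet> sgn \<xi>\<bar> powr \<alpha>)"
      by simp
    also have "\<dots> = ?\<psi> \<xi>"
    proof (rule Bochner_Integration.integral_cong[OF refl])
      fix y
      have "norm \<xi> powr \<alpha> * \<bar>y \<bullet> sgn \<xi>\<bar> powr \<alpha> = \<bar>norm \<xi> * (y \<bullet> sgn \<xi>)\<bar> powr \<alpha>"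
        by (simp add: abs_mult powr_mult)
      also have "norm \<xi> * (y \<bullet> sgn \<xi>) = y \<bullet> \<xi>"
        using False by (simp add: sgn_div_norm)
      finally show "norm \<xi> powr \<alpha> * \<bar>y \<bullet> sgn \<xi>\<bar> powr \<alpha> = \<bar>y \<bullet> \<xi>\<bar> powr \<alpha>" .
    qed
    finally show ?thesis by (simp add: mult.commute)
  qed (use assms in simp)
  ultimately show thesis by (rule that)
qed

lemma (in borel_prob) borel_measurable_cf:
  "(\<lambda>\<xi>. CLINT y|\<mu>. iexp (y \<bullet> \<xi>)) \<in> borel_measurable borel"
  by measurable

lemma stable_law_fourier_decay:
  fixes \<sigma> \<mu> :: "(real^'n) measure"
  assumes "1 < \<alpha>" "nondegenerate \<alpha> \<sigma>" "stable_law \<alpha> \<sigma> \<mu>"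
  obtains q where "fourier_decay \<mu> q"
proof -
  let ?\<psi> = "\<lambda>\<xi>. LINT y|spectral_measure \<alpha> \<sigma>. \<bar>y \<bullet> \<xi>\<bar> powr \<alpha>"
  have bp: "borel_prob \<mu>"
    using assms(3) by (simp add: stable_law_def borel_prob_def borel_prob_axioms_def)
  interpret borel_prob \<mu> by fact
  have cf: "(CLINT y|\<mu>. iexp (y \<bullet> \<xi>)) = complex_of_real (exp (- ?\<psi> \<xi>))" for \<xi>
    using assms(3) by (simp add: stable_law_def)
  obtain c where c: "0 < c" "\<And>\<xi>. c * norm \<xi> powr \<alpha> \<le> ?\<psi> \<xi>"
    using nondegenerate_lower_bound[OF assms(2)] assms(1) by auto
  have [measurable]: "(\<lambda>\<xi>. exp (- ?\<psi> \<xi>)) \<in> borel_measurable borel"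
  proof -
    \<comment> \<open>Measurability in \<open>\<xi>\<close> is read off from the characteristic
      function, a parameter integral against \<open>\<mu>\<close> whose real part is this
      exponential.\<close>
    have "(\<lambda>\<xi>. Re (CLINT y|\<mu>. iexp (y \<bullet> \<xi>))) \<in> borel_measurable borel"
      by (intro borel_measurable_Re[THEN measurable_compose[rotated]] borel_measurable_cf)
    then show ?thesis unfolding cf by simp
  qed
  have "integrable lborel (\<lambda>\<xi>::real^'n. 2 / c * exp c * exp (- (c / 2) * norm \<xi>))"
    using c(1) by (intro integrable_mult_right integrable_exp_neg_norm) simp
  then have "integrable lborel (\<lambda>\<xi>. norm \<xi> * exp (- ?\<psi> \<xi>))"
  proof (rule Bochner_Integration.integrable_bound)
    have "norm \<xi> * exp (- ?\<psi> \<xi>) \<le> 2 / c * exp c * exp (- (c / 2) * norm \<xi>)" for \<xi>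
    proof -
      have "norm \<xi> * exp (- ?\<psi> \<xi>) \<le> norm \<xi> * exp (- (c * norm \<xi> powr \<alpha>))"
        using c(2)[of \<xi>] by (intro mult_left_mono) auto
      also have "\<dots> \<le> 2 / c * exp c * exp (- (c / 2) * norm \<xi>)"
        by (rule norm_mult_exp_powr_le) (use c assms in auto)
      finally show ?thesis .
    qed
    then show "AE \<xi> in lborel. norm (norm \<xi> * exp (- ?\<psi> \<xi>)) \<le> norm (2 / c * exp c * exp (- (c / 2) * norm \<xi>))"
      using c(1) by (intro AE_I2) (auto simp: abs_mult)
  qed measurable
  then have "fourier_decay \<mu> (\<lambda>\<xi>. exp (- ?\<psi> \<xi>))"
    using cf bp by (simp add: fourier_decay_def fourier_decay_axioms_def)
  then show thesis by (rule that)
qed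

section \<open>Regularisation of indicator functions\<close>

lemma emeasure_lborel_affine_vimage:
  fixes E :: "'a::euclidean_space set"
  assumes [measurable]: "E \<in> sets borel" and "0 < s"
  shows "emeasure lborel E = ennreal (s ^ DIM('a)) * emeasure lborel {y. x + s *\<^sub>R y \<in> E}"
proof -
  have "emeasure lborel E = emeasure (density (distr lborel borel (\<lambda>y. x + s *\<^sub>R y)) (\<lambda>_. ennreal (\<bar>s\<bar> ^ DIM('a)))) E"
    using lborel_affine[of s x] assms(2) by simp
  also have "\<dots> = ennreal (s ^ DIM('a)) * emeasure (distr lborel borel (\<lambda>y. x + s *\<^sub>R y)) E"
    using assms(2) by (simp add: emeasure_density nn_integral_cmult_indicator)
  also have "emeasure (distr lborel borel (\<lambda>y. x + s *\<^sub>R y)) E = emeasure lborel {y. x + s *\<^sub>R y \<in> E}"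
    by (subst emeasure_distr) (auto simp: vimage_def)
  finally show ?thesis .
qed

text \<open>The value at \<open>x\<close> is the \<open>\<mu>\<close>-measure of the rescaled set of
  \<open>y\<close> with \<open>x + s *\<^sub>R y\<close> in \<open>E\<close>. Moving
  \<open>x\<close> by \<open>u\<close> translates that set by \<open>u /\<^sub>R s\<close>, and its
  volume is that of \<open>E\<close> divided by \<open>s ^ DIM('a)\<close>;
  \<open>translate_le\<close> then applies.\<close>

lemma (in fourier_decay) bdd_lip_translate_indicator:
  assumes E[measurable]: "E \<in> sets borel" and fin: "emeasure lborel E < \<infinity>" and s: "0 < s"
  obtains M where "bdd_lip M (\<lambda>x. LINT y|\<mu>. indicator E (x + s *\<^sub>R y) :: real)"
proof -
  let ?f = "\<lambda>x. LINT y|\<mu>. indicator E (x + s *\<^sub>R y) :: real"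
  let ?A = "\<lambda>x. {y. x + s *\<^sub>R y \<in> E}"
  let ?m = "measure lborel E / s ^ DIM('a)"
  have sp: "space \<mu> = UNIV" using sets_eq_imp_space_eq[OF sets_mu] by simp
  have A[measurable]: "?A x \<in> sets borel" for x
  proof -
    have "{y \<in> space borel. x + s *\<^sub>R y \<in> E} \<in> sets borel" by measurable
    then show ?thesis by simp
  qed
  have Afin: "emeasure lborel (?A x) < \<infinity>" for x
    using fin emeasure_lborel_affine_vimage[OF E s, of x] zero_less_power[OF s, of "DIM('a)"]
    by (auto simp: ennreal_mult_less_top ennreal_eq_0_iff)
  have Am: "measure lborel (?A x) = ?m" for x
    using s emeasure_lborel_affine_vimage[OF E s, of x] by (simp add: measure_def enn2real_mult)
  have f: "?f x = measure \<mu> (?A x)" for x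
  proof -
    have "?f x = (LINT y|\<mu>. indicator (?A x) y)"
      by (intro Bochner_Integration.integral_cong) (auto simp: indicator_def)
    then show ?thesis by (simp add: sp)
  qed
  have le: "?f (x + u) - ?f x \<le> lip * (norm u / s) * ?m" for x u
  proof -
    have "?A (x + u) = {y. y + u /\<^sub>R s \<in> ?A x}"
      using s by (auto simp: scaleR_add_right algebra_simps)
    then have "?f (x + u) \<le> measure \<mu> (?A x) + lip * norm (u /\<^sub>R s) * measure lborel (?A x)"
      using translate_le[OF A Afin, of "u /\<^sub>R s" x] by (simp add: f)
    then show ?thesis using s by (simp add: f Am divide_inverse mult.commute)
  qed
  have "bdd_lip (max 2 (lip / s * ?m)) ?f"
  proof (rule bdd_lipI[where A = 1 and B = "lip / s * ?m"])
    show "norm (?f x) \<le> 1" for x by (simp add: f)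
    \<comment> \<open>The one-sided bound at \<open>x\<close> and the one at \<open>x + u\<close>
      with increment \<open>- u\<close> together bound the absolute value.\<close>
    show "norm (?f (x + u) - ?f x) \<le> lip / s * ?m * norm u" for x u
      using le[of x u] le[of "x + u" "- u"] by (simp add: abs_le_iff mult_ac)
  qed auto
  then show thesis by (rule that)
qed

context borel_prob
begin

lemma avg_tendsto:
  fixes h :: "'a \<Rightarrow> real"
  assumes h: "continuous_on UNIV h" "\<And>x. \<bar>h x\<bar> \<le> C" and X: "X \<longlonglongrightarrow> 0"
  shows "(\<lambda>n. avg \<mu> (X n) h x) \<longlonglongrightarrow> h x"
proof -
  have [measurable]: "h \<in> borel_measurable borel" using h(1) by (rule borel_measurable_continuous_onI)
  have "(\<lambda>n. LINT y|\<mu>. h (x - X n *\<^sub>R y)) \<longlonglongrightarrow> (LINT y|\<mu>. h x)"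
  proof (rule integral_dominated_convergence[where w = "\<lambda>_. C"])
    have "(\<lambda>n. x - X n *\<^sub>R y) \<longlonglongrightarrow> x - 0 *\<^sub>R y" for y by (intro tendsto_intros X)
    then show "AE y in \<mu>. (\<lambda>n. h (x - X n *\<^sub>R y)) \<longlonglongrightarrow> h x"
      by (intro AE_I2 continuous_on_tendsto_compose[OF h(1)]) auto
  qed (use h(2) in auto)
  then show ?thesis by (simp add: avg_def prob_space)
qed

lemma integral_avg_tendsto:
  fixes h :: "'a \<Rightarrow> real"
  assumes E[measurable]: "E \<in> sets borel" and fin: "emeasure lborel E < \<infinity>"
    and h: "continuous_on UNIV h" "\<And>x. \<bar>h x\<bar> \<le> C"
  shows "((\<lambda>s. LINT x|lborel. indicator E x * avg \<mu> s h x) \<longlongrightarrow> (LINT x|lborel. indicator E x * h x)) (at_right 0)"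
  unfolding tendsto_at_iff_sequentially comp_def
proof safe
  fix X :: "nat \<Rightarrow> real" assume X: "X \<longlonglongrightarrow> 0"
  have [measurable]: "h \<in> borel_measurable borel" using h(1) by (rule borel_measurable_continuous_onI)
  have [measurable]: "avg \<mu> s h \<in> borel_measurable borel" for s
    unfolding avg_def[abs_def] by measurable
  have "integrable lborel (indicator E :: 'a \<Rightarrow> real)"
    using fin by (simp add: integrable_indicator_iff)
  then have int: "integrable lborel (\<lambda>x. indicator E x * C)" by simp
  show "(\<lambda>n. LINT x|lborel. indicator E x * avg \<mu> (X n) h x) \<longlonglongrightarrow> (LINT x|lborel. indicator E x * h x)"
  proof (rule integral_dominated_convergence[where w = "\<lambda>x. indicator E x * C"])
    show "AE x in lborel. (\<lambda>n. indicator E x * avg \<mu> (X n) h x) \<longlonglongrightarrow> indicator E x * h x"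
      by (intro AE_I2 tendsto_mult_left avg_tendsto[OF h X])
    show "AE x in lborel. norm (indicator E x * avg \<mu> (X n) h x) \<le> indicator E x * C" for n
      using norm_avg_le[OF h(1), of C "X n"] h(2) by (auto simp: abs_mult split: split_indicator)
  qed (use int in auto)
qed

end

section \<open>Duality for the total variation norm\<close>

text \<open>The extremal field \<open>- g / \<bar>g\<bar>\<close> is regularised to the continuous field \<open>- g / (\<bar>g\<bar> + \<epsilon>)\<close>,
  approximated by a polynomial field on a ball, and cut off outside that ball.\<close>

lemma L1_cutoff_le:
  fixes g :: "real^'n \<Rightarrow> real^'n"
  assumes g: "continuous_on UNIV g" "\<And>x. norm (g x) \<le> B"
    and V: "\<And>\<phi>. test_fn \<phi> \<Longrightarrow> (\<And>x. norm (\<phi> x) \<le> 1) \<Longrightarrow> - (LINT x|lborel. \<phi> x \<bullet> g x) \<le> V"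
    and R: "0 < R"
  shows "integrable lborel (\<lambda>x. cutoff R x * norm (g x))"
    and "(LINT x|lborel. cutoff R x * norm (g x)) \<le> V"
proof -
  have B: "0 \<le> B" using g(2)[of 0] norm_ge_zero order_trans by blast
  \<comment> \<open>The zero field shows that \<open>V\<close> is nonnegative, which the final
    choice of \<epsilon> relies on.\<close>
  have "test_fn (\<lambda>x. 0 :: real^'n)"
    by (auto simp: test_fn_def bdd_supp_def intro: cont_diff_const)
  from V[OF this] have V0: "0 \<le> V" by simp
  have cc: "continuous_on UNIV (cutoff R :: real^'n \<Rightarrow> real)"
    by (rule cont_diff_imp_continuous[OF cont_diff_cutoff])
  have [measurable]: "g \<in> borel_measurable borel" "(cutoff R :: real^'n \<Rightarrow> real) \<in> borel_measurable borel"
    using g(1) cc by (auto intro: borel_measurable_continuous_onI)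
  let ?K = "cball 0 R :: (real^'n) set"
  have K: "integrable lborel (\<lambda>x. a * indicator ?K x :: real)" for a
    using emeasure_bounded_finite[OF bounded_cball, of 0 R]
    by (intro integrable_mult_right) (simp add: integrable_indicator_iff)
  show int: "integrable lborel (\<lambda>x. cutoff R x * norm (g x))"
  proof (rule Bochner_Integration.integrable_bound[OF K[of B]])
    have "norm (cutoff R x * norm (g x)) \<le> norm (B * indicator ?K x)" for x
    proof (cases "x \<in> ?K")
      case True
      have "cutoff R x * norm (g x) \<le> 1 * B"
        by (intro mult_mono cutoff_le_1 g cutoff_nonneg) auto
      with True B show ?thesis by (simp add: cutoff_nonneg)
    next
      case False
      then show ?thesis using cutoff_eq_0[OF R, of x] by simp
    qed
    then show "AE x in lborel. norm (cutoff R x * norm (g x)) \<le> norm (B * indicator ?K x)"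
      by (rule AE_I2)
  qed measurable
  let ?I = "LINT x|lborel. cutoff R x * norm (g x)"
  let ?W = "measure lborel ?K"
  have approx: "?I \<le> V + \<epsilon> * (V + (1 + B) * ?W)" if \<epsilon>: "0 < \<epsilon>" for \<epsilon>
  proof -
    define w where "w x = - (inverse (norm (g x) + \<epsilon>) *\<^sub>R g x)" for x
    have pos: "0 < norm (g x) + \<epsilon>" for x using \<epsilon> by (simp add: add_nonneg_pos)
    have "continuous_on ?K w"
      unfolding w_def using pos
      by (intro continuous_intros continuous_on_subset[OF g(1)]) (auto simp: less_le)
    from Stone_Weierstrass_polynomial_function[OF compact_cball this \<epsilon>]
    obtain P where P: "polynomial_function P" "\<And>x. x \<in> ?K \<Longrightarrow> norm (w x - P x) < \<epsilon>"
      by metis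
    have w1: "norm (w x) \<le> 1" for x
      using pos[of x] \<epsilon> by (simp add: w_def field_simps)
    \<comment> \<open>On the ball \<open>P\<close> has norm at most \<open>1 + \<epsilon>\<close>,
      as it is within \<epsilon> of \<open>w\<close>; dividing by \<open>1 + \<epsilon>\<close>
      restores the bound 1.\<close>
    define \<phi> where "\<phi> x = (inverse (1 + \<epsilon>) * cutoff R x) *\<^sub>R P x" for x
    have \<phi>0: "\<phi> x = 0" if "x \<notin> ?K" for x
      using that cutoff_eq_0[OF R, of x] by (simp add: \<phi>_def)
    have "test_fn \<phi>"
      unfolding test_fn_def
    proof safe
      fix k
      have "cont_diff k (\<lambda>x. inverse (1 + \<epsilon>) * cutoff R x :: real)"
        by (rule cont_diff_bilinear[OF bounded_bilinear_mult cont_diff_const cont_diff_cutoff])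
      then show "cont_diff k \<phi>"
        unfolding \<phi>_def[abs_def]
        by (rule cont_diff_bilinear[OF bounded_bilinear_scaleR _ cont_diff_polynomial_function[OF P(1)]])
    next
      show "bdd_supp \<phi>"
        unfolding bdd_supp_def by (intro exI[of _ R]) (auto intro: \<phi>0)
    qed
    moreover have "norm (\<phi> x) \<le> 1" for x
    proof (cases "x \<in> ?K")
      case True
      have "norm (P x) \<le> norm (w x) + norm (w x - P x)"
        by (metis norm_minus_commute norm_triangle_sub)
      then have "norm (P x) \<le> 1 + \<epsilon>" using P(2)[OF True] w1[of x] by linarith
      then have "(inverse (1 + \<epsilon>) * cutoff R x) * norm (P x) \<le> (inverse (1 + \<epsilon>) * 1) * (1 + \<epsilon>)"
        using \<epsilon> by (intro mult_mono mult_left_mono cutoff_le_1 mult_nonneg_nonneg cutoff_nonneg) auto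
      then show ?thesis using \<epsilon> by (simp add: \<phi>_def abs_mult cutoff_nonneg)
    qed (simp add: \<phi>0)
    ultimately have "- (LINT x|lborel. \<phi> x \<bullet> g x) \<le> V" by (rule V)
    moreover have int\<phi>: "integrable lborel (\<lambda>x. \<phi> x \<bullet> g x)"
    proof (rule Bochner_Integration.integrable_bound[OF K[of B]])
      have [measurable]: "\<phi> \<in> borel_measurable borel"
        using \<open>test_fn \<phi>\<close> by (intro borel_measurable_continuous_onI test_fn_continuous)
      show "(\<lambda>x. \<phi> x \<bullet> g x) \<in> borel_measurable lborel" by measurable
      have "\<bar>\<phi> x \<bullet> g x\<bar> \<le> 1 * B" for x
        by (rule order_trans[OF Cauchy_Schwarz_ineq2])
           (intro mult_mono g \<open>\<And>x. norm (\<phi> x) \<le> 1\<close>, auto)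
      then show "AE x in lborel. norm (\<phi> x \<bullet> g x) \<le> norm (B * indicator ?K x)"
        using \<phi>0 B by (auto split: split_indicator intro!: AE_I2)
    qed
    \<comment> \<open>Pointwise on the ball, regularising the denominator loses at most \<epsilon>,
      because |g|^2 / (|g| + \<epsilon>) is at least |g| - \<epsilon>, and replacing
      \<open>w\<close> by \<open>P\<close> loses at most \<open>\<epsilon> * B\<close>. The factor
      \<open>1 + \<epsilon>\<close> undoes the normalisation of \<phi>.\<close>
    moreover have "?I - \<epsilon> * (1 + B) * ?W \<le> (1 + \<epsilon>) * - (LINT x|lborel. \<phi> x \<bullet> g x)"
    proof -
      have "?I - \<epsilon> * (1 + B) * ?W = (LINT x|lborel. cutoff R x * norm (g x) - \<epsilon> * (1 + B) * indicator ?K x)"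
        using int K[of "\<epsilon> * (1 + B)"] by simp
      also have "\<dots> \<le> (LINT x|lborel. (1 + \<epsilon>) * - (\<phi> x \<bullet> g x))"
      proof (rule integral_mono)
        show "integrable lborel (\<lambda>x. cutoff R x * norm (g x) - \<epsilon> * (1 + B) * indicator ?K x)"
          using int K[of "\<epsilon> * (1 + B)"] by (rule Bochner_Integration.integrable_diff)
        show "integrable lborel (\<lambda>x. (1 + \<epsilon>) * - (\<phi> x \<bullet> g x))" using int\<phi> by simp
        fix x
        show "cutoff R x * norm (g x) - \<epsilon> * (1 + B) * indicator ?K x \<le> (1 + \<epsilon>) * - (\<phi> x \<bullet> g x)"
        proof (cases "x \<in> ?K")
          case True
          have "(norm (g x) - \<epsilon>) * (norm (g x) + \<epsilon>) \<le> (norm (g x))\<^sup>2"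
            by (simp add: algebra_simps power2_eq_square)
          then have "norm (g x) - \<epsilon> \<le> (norm (g x))\<^sup>2 / (norm (g x) + \<epsilon>)"
            using pos[of x] by (simp add: pos_le_divide_eq)
          also have "\<dots> = - (w x \<bullet> g x)"
            by (simp add: w_def power2_norm_eq_inner divide_inverse mult.commute)
          finally have 1: "norm (g x) - \<epsilon> \<le> - (w x \<bullet> g x)" .
          have "\<bar>(w x - P x) \<bullet> g x\<bar> \<le> \<epsilon> * B"
            by (rule order_trans[OF Cauchy_Schwarz_ineq2])
               (intro mult_mono g less_imp_le[OF P(2)[OF True]], use \<epsilon> in auto)
          then have "norm (g x) - \<epsilon> * (1 + B) \<le> - (P x \<bullet> g x)"
            using 1 by (simp add: inner_diff_left algebra_simps)
          then have "cutoff R x * (norm (g x) - \<epsilon> * (1 + B)) \<le> cutoff R x * - (P x \<bullet> g x)"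
            by (rule mult_left_mono) (rule cutoff_nonneg)
          moreover have "cutoff R x * (\<epsilon> * (1 + B)) \<le> 1 * (\<epsilon> * (1 + B))"
            using \<epsilon> B by (intro mult_right_mono cutoff_le_1) auto
          moreover have "(1 + \<epsilon>) * - (\<phi> x \<bullet> g x) = cutoff R x * - (P x \<bullet> g x)"
            using \<epsilon> by (simp add: \<phi>_def)
          ultimately show ?thesis using True by (simp add: algebra_simps)
        next
          case False
          then show ?thesis using cutoff_eq_0[OF R, of x] \<phi>0[OF False] by simp
        qed
      qed
      finally show ?thesis using int\<phi> by simp
    qed
    ultimately have "?I - \<epsilon> * (1 + B) * ?W \<le> (1 + \<epsilon>) * V"
      using \<epsilon> by (smt (verit) mult_left_mono)
    then show ?thesis by (simp add: algebra_simps)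
  qed
  show "?I \<le> V"
  proof (rule field_le_epsilon)
    fix e :: real assume "0 < e"
    let ?T = "V + (1 + B) * ?W"
    have T: "0 \<le> ?T" using V0 B by simp
    \<comment> \<open>Here \<open>approx\<close> is used with parameter \<open>e / (?T + 1)\<close>;
      the added 1 keeps the denominator positive when \<open>?T\<close> is 0.\<close>
    then have "?I \<le> V + e / (?T + 1) * ?T"
      using \<open>0 < e\<close> by (intro approx) simp
    also have "e / (?T + 1) * ?T \<le> e"
      using T \<open>0 < e\<close> by (simp add: field_simps)
    finally show "?I \<le> V + e" by simp
  qed
qed

text \<open>Fatou's lemma along the cutoffs of radius \<open>Suc n\<close> removes the localisation
  of \<open>L1_cutoff_le\<close>, whose bound \<open>V\<close> does not involve the radius.\<close>

lemma L1_le: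
  fixes g :: "real^'n \<Rightarrow> real^'n"
  assumes g: "continuous_on UNIV g" "\<And>x. norm (g x) \<le> B"
    and V: "\<And>\<phi>. test_fn \<phi> \<Longrightarrow> (\<And>x. norm (\<phi> x) \<le> 1) \<Longrightarrow> - (LINT x|lborel. \<phi> x \<bullet> g x) \<le> V"
  shows "(\<integral>\<^sup>+x. ennreal (norm (g x)) \<partial>lborel) \<le> ennreal V"
proof -
  have [measurable]: "g \<in> borel_measurable borel"
    using g(1) by (rule borel_measurable_continuous_onI)
  have [measurable]: "(cutoff R :: real^'n \<Rightarrow> real) \<in> borel_measurable borel" for R
    by (intro borel_measurable_continuous_onI cont_diff_imp_continuous[OF cont_diff_cutoff])
  let ?u = "\<lambda>n x. ennreal (cutoff (real (Suc n)) x * norm (g x))"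
  have "(\<lambda>n. ?u n x) \<longlonglongrightarrow> ennreal (1 * norm (g x))" for x
    by (intro tendsto_ennrealI tendsto_mult tendsto_const cutoff_tendsto)
  then have "(\<integral>\<^sup>+x. ennreal (norm (g x)) \<partial>lborel) = (\<integral>\<^sup>+x. liminf (\<lambda>n. ?u n x) \<partial>lborel)"
    by (intro nn_integral_cong lim_imp_Liminf[OF trivial_limit_sequentially, symmetric]) simp
  also have "\<dots> \<le> liminf (\<lambda>n. \<integral>\<^sup>+x. ?u n x \<partial>lborel)"
    by (rule nn_integral_liminf) measurable
  also have "\<dots> \<le> ennreal V"
  proof (rule Liminf_le)
    have "(\<integral>\<^sup>+x. ?u n x \<partial>lborel) \<le> ennreal V" for n
    proof -
      have R: "0 < real (Suc n)" by simp
      have "(\<integral>\<^sup>+x. ?u n x \<partial>lborel) = ennreal (LINT x|lborel. cutoff (real (Suc n)) x * norm (g x))"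
        by (rule nn_integral_eq_integral[OF L1_cutoff_le(1)[OF g V R]])
           (auto simp: cutoff_nonneg)
      also have "\<dots> \<le> ennreal V"
        by (intro ennreal_leI L1_cutoff_le(2)[OF g V R])
      finally show ?thesis .
    qed
    then show "\<forall>\<^sub>F n in sequentially. (\<integral>\<^sup>+x. ?u n x \<partial>lborel) \<le> ennreal V" by simp
    show "sequentially \<noteq> bot" by (rule trivial_limit_sequentially)
  qed
  finally show ?thesis .
qed

section \<open>Equality of the two perimeters\<close>

theorem proposition7p2:
  fixes \<alpha> :: real and \<sigma> \<mu> :: "(real^'n) measure" and E :: "(real^'n) set"
  assumes "1 < \<alpha>" and "\<alpha> < 2"
    and "symmetric_sphere_measure \<sigma>"
    and "nondegenerate \<alpha> \<sigma>"
    and "stable_law \<alpha> \<sigma> \<mu>"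
    and "E \<in> sets borel"
    and "emeasure lborel E < \<infinity>"
  shows "frac_perimeter_var (stable_levy_measure \<alpha> \<sigma>) E
       = frac_perimeter \<alpha> (stable_levy_measure \<alpha> \<sigma>) \<mu> E"
proof -
  define \<nu> where "\<nu> = stable_levy_measure \<alpha> \<sigma>"
  have levy: "symmetric_levy_measure \<nu>"
    unfolding \<nu>_def by (rule symmetric_levy_measure_stable[OF assms(1-3)])
  interpret \<nu>: symmetric_levy_measure \<nu> by fact
  obtain q where "fourier_decay \<mu> q"
    using stable_law_fourier_decay[OF assms(1,4,5)] .
  then interpret fourier_decay \<mu> q .
  note E[measurable] = assms(6) and fin = assms(7)
  have indE: "integrable lborel (indicator E :: real^'n \<Rightarrow> real)"
    using fin by (simp add: integrable_indicator_iff)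
  define V where "V = frac_perimeter_var \<nu> E"
  define f where "f t = stable_semigroup \<alpha> \<mu> t (indicator E)" for t
  define F where "F t = L1_norm (frac_gradient \<nu> (f t))" for t
  \<comment> \<open>The common term of both inequalities: it is at most \<open>V\<close>
    (\<open>J_le\<close>), for \<open>s = t powr (1 / \<alpha>)\<close> it is minus the pairing of
    \<phi> with the gradient (\<open>duality_f\<close>), and it converges to the divergence integral
    over \<open>E\<close> (\<open>J_tendsto\<close>).\<close>
  define J where "J s \<phi> = (LINT x|lborel. indicator E x * avg \<mu> s (vdiv \<nu> \<phi>) x)"
    for s and \<phi> :: "real^'n \<Rightarrow> real^'n"

  have V_upper: "ereal (LINT x|lborel. indicator E x * vdiv \<nu> \<phi> x) \<le> V"
    if \<phi>: "test_fn \<phi>" "\<And>x. norm (\<phi> x) \<le> 1" for \<phi>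
  proof -
    obtain M where "bdd_lip M \<phi>" using test_fn_bdd_lip[OF \<phi>(1)] .
    then have "(LINT x:E|lborel. frac_div \<nu> \<phi> x) = (LINT x|lborel. indicator E x * vdiv \<nu> \<phi> x)"
      by (simp add: set_lebesgue_integral_def frac_div_eq_vdiv[OF levy])
    then show ?thesis
      unfolding V_def frac_perimeter_var_def
      using \<phi> SUP_norm_le_iff[OF \<phi>(1), of 1]
      by (intro Sup_upper) (auto simp: test_fields_iff intro!: exI[of _ \<phi>])
  qed

  have J_le: "ereal (J s \<phi>) \<le> V" if \<phi>: "test_fn \<phi>" "\<And>x. norm (\<phi> x) \<le> 1" for s \<phi>
  proof -
    let ?\<psi> = "avg \<mu> s \<phi>"
    \<comment> \<open>The average need not have bounded support, hence the cutoffs. Radius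
      \<open>Suc n\<close> is at least 1, as the uniform constant of \<open>bdd_lip_cutoff\<close>
      requires; the resulting constant \<open>N + M\<close> is free of \<open>n\<close> and
      dominates the divergences over the finite volume of \<open>E\<close>.\<close>
    let ?\<psi>n = "\<lambda>n x. cutoff (real (Suc n)) x *\<^sub>R ?\<psi> x"
    obtain M where M: "bdd_lip M \<phi>" using test_fn_bdd_lip[OF \<phi>(1)] .
    obtain N where N: "\<And>R. 1 \<le> R \<Longrightarrow> bdd_lip N (cutoff R :: real^'n \<Rightarrow> real)" using bdd_lip_cutoff by blast
    have \<psi>1: "norm (?\<psi> x) \<le> 1" for x by (rule norm_avg_le[OF bdd_lip_continuous[OF M] \<phi>(2)])
    have bdd_lip\<psi>: "bdd_lip M ?\<psi>" by (rule bdd_lip_avg[OF M \<phi>(2)])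
    have bln: "bdd_lip (N + M) (?\<psi>n n)" for n
      by (rule bdd_lip_mult[OF N bdd_lip\<psi> _ \<psi>1]) (auto simp: cutoff_nonneg cutoff_le_1)
    have test: "test_fn (?\<psi>n n)" for n
      unfolding test_fn_def
    proof safe
      show "cont_diff k (?\<psi>n n)" for k
        by (rule cont_diff_bilinear[OF bounded_bilinear_scaleR cont_diff_cutoff cont_diff_avg[OF \<phi>(1)]])
      show "bdd_supp (?\<psi>n n)"
        unfolding bdd_supp_def by (intro exI[of _ "real (Suc n)"]) (auto simp: cutoff_eq_0 simp del: of_nat_Suc)
    qed
    have norm1: "norm (?\<psi>n n x) \<le> 1" for n x
      using mult_mono[OF cutoff_le_1[of "real (Suc n)" x] \<psi>1[of x]]
      by (simp add: cutoff_nonneg del: of_nat_Suc)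
    have "(\<lambda>n. LINT x|lborel. indicator E x * vdiv \<nu> (?\<psi>n n) x)
        \<longlonglongrightarrow> (LINT x|lborel. indicator E x * vdiv \<nu> ?\<psi> x)"
    proof (rule integral_dominated_convergence[where w = "\<lambda>x. indicator E x * ((N + M) * \<nu>.first_moment)"])
      have [measurable]: "vdiv \<nu> (?\<psi>n n) \<in> borel_measurable borel" for n
        by (rule borel_measurable_continuous_onI[OF \<nu>.vdiv_continuous[OF bln]])
      have [measurable]: "vdiv \<nu> ?\<psi> \<in> borel_measurable borel"
        by (rule borel_measurable_continuous_onI[OF \<nu>.vdiv_continuous[OF bdd_lip\<psi>]])
      show "(\<lambda>x. indicator E x * vdiv \<nu> ?\<psi> x) \<in> borel_measurable lborel"
        "\<And>n. (\<lambda>x. indicator E x * vdiv \<nu> (?\<psi>n n) x) \<in> borel_measurable lborel"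
        by measurable
      show "integrable lborel (\<lambda>x. indicator E x * ((N + M) * \<nu>.first_moment))"
        using indE by simp
      have "(\<lambda>n. ?\<psi>n n x) \<longlonglongrightarrow> 1 *\<^sub>R ?\<psi> x" for x
        by (intro tendsto_scaleR tendsto_const cutoff_tendsto)
      then show "AE x in lborel. (\<lambda>n. indicator E x * vdiv \<nu> (?\<psi>n n) x) \<longlonglongrightarrow> indicator E x * vdiv \<nu> ?\<psi> x"
        by (intro AE_I2 tendsto_mult_left \<nu>.vdiv_tendsto[OF bln bdd_lip\<psi>]) simp
      show "AE x in lborel. norm (indicator E x * vdiv \<nu> (?\<psi>n n) x) \<le> indicator E x * ((N + M) * \<nu>.first_moment)" for n
        using \<nu>.vdiv_bounded[OF bln] by (intro AE_I2) (auto split: split_indicator)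
    qed
    then have "ereal (LINT x|lborel. indicator E x * vdiv \<nu> ?\<psi> x) \<le> V"
      by (intro LIMSEQ_le_const2[OF tendsto_ereal]) (auto intro!: V_upper test norm1 simp del: of_nat_Suc)
    then show ?thesis by (simp add: J_def vdiv_avg[OF levy M \<phi>(2)])
  qed

  have duality_f: "- (LINT x|lborel. \<phi> x \<bullet> vgrad \<nu> (f t) x) = J (t powr (1 / \<alpha>)) \<phi>"
    and f_bdd_lip: "\<exists>L. bdd_lip L (f t)"
    if t: "0 < t" and \<phi>: "test_fn \<phi>" for t and \<phi> :: "real^'n \<Rightarrow> real^'n"
  proof -
    let ?s = "t powr (1 / \<alpha>)"
    have f: "f t = (\<lambda>x. LINT y|\<mu>. indicator E (x + ?s *\<^sub>R y))"
      by (simp add: f_def stable_semigroup_def fun_eq_iff)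
    show "\<exists>L. bdd_lip L (f t)"
      using bdd_lip_translate_indicator[OF E fin, of ?s] t unfolding f by auto
    then obtain L where L: "bdd_lip L (f t)" ..
    obtain M where M: "bdd_lip M \<phi>" using test_fn_bdd_lip[OF \<phi>] .
    have int: "integrable lborel (f t)"
      using integrable_translate_mult[OF E fin, of "\<lambda>_. 1" 1 ?s] by (simp add: f)
    have f1: "\<bar>f t x\<bar> \<le> 1" for x
    proof -
      have "norm (LINT y|\<mu>. indicator E (x + ?s *\<^sub>R y) :: real) \<le> (LINT y|\<mu>. 1)"
        by (rule Bochner_Integration.integral_norm_bound_integral)
           (auto intro!: integrable_const_bound[where B = 1] split: split_indicator)
      then show ?thesis by (simp add: f prob_space)
    qed
    have "- (LINT x|lborel. \<phi> x \<bullet> vgrad \<nu> (f t) x) = (LINT x|lborel. f t x * vdiv \<nu> \<phi> x)"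
      using \<nu>.duality[OF L int f1 M test_fn_integrable[OF \<phi>]] by simp
    also have "\<dots> = J ?s \<phi>"
      unfolding f J_def
      by (rule integral_translate_mult[OF E fin \<nu>.vdiv_continuous[OF M] \<nu>.vdiv_bounded[OF M]])
    finally show "- (LINT x|lborel. \<phi> x \<bullet> vgrad \<nu> (f t) x) = J ?s \<phi>" .
  qed

  \<comment> \<open>The zero field discharges the test-field premise of \<open>f_bdd_lip\<close>,
    which speaks of \<open>t\<close> alone, and shows that \<open>V\<close> is nonnegative.\<close>
  have zero: "test_fn (\<lambda>x. 0 :: real^'n)"
    by (auto simp: test_fn_def bdd_supp_def intro: cont_diff_const)
  have F: "F t = enn2ereal (\<integral>\<^sup>+x. ennreal (norm (vgrad \<nu> (f t) x)) \<partial>lborel)" for t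
    by (simp add: F_def L1_norm_def frac_gradient_eq_vgrad)

  \<comment> \<open>\<open>V\<close> is an extended real: an infinite value is trivial, minus
    infinity is excluded by the zero field, and a finite one is the real bound fed to
    \<open>L1_le\<close>.\<close>
  have F_le: "F t \<le> V" if t: "0 < t" for t
  proof (cases V)
    case (real v)
    obtain L where L: "bdd_lip L (f t)" using f_bdd_lip[OF t zero] ..
    have v0: "0 \<le> v" using J_le[OF zero, of 0] real by (simp add: J_def vdiv_def avg_def)
    have "(\<integral>\<^sup>+x. ennreal (norm (vgrad \<nu> (f t) x)) \<partial>lborel) \<le> ennreal v"
    proof (rule L1_le[OF \<nu>.vgrad_continuous[OF L] \<nu>.vgrad_bounded[OF L]])
      show "- (LINT x|lborel. \<phi> x \<bullet> vgrad \<nu> (f t) x) \<le> v"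
        if "test_fn \<phi>" "\<And>x. norm (\<phi> x) \<le> 1" for \<phi>
        using J_le[OF that] real by (simp add: duality_f[OF t that(1)])
    qed
    then have "F t \<le> enn2ereal (ennreal v)" unfolding F by (simp only: less_eq_ennreal.rep_eq)
    then show ?thesis using v0 real by (simp add: enn2ereal_ennreal)
  next
    case MInf
    with J_le[OF zero, of 0] show ?thesis by simp
  qed simp

  \<comment> \<open>Pairing with a field of norm at most one is bounded by the norm in
    \<open>L\<^sup>1\<close>. The estimate runs in \<open>ennreal\<close>, since \<open>F t\<close>
    may be infinite.\<close>
  have F_ge: "ereal (J (t powr (1 / \<alpha>)) \<phi>) \<le> F t"
    if t: "0 < t" and \<phi>: "test_fn \<phi>" "\<And>x. norm (\<phi> x) \<le> 1" for t \<phi>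
  proof -
    obtain L where L: "bdd_lip L (f t)" using f_bdd_lip[OF t zero] ..
    let ?g = "vgrad \<nu> (f t)"
    have [measurable]: "?g \<in> borel_measurable borel" "\<phi> \<in> borel_measurable borel"
      using \<nu>.vgrad_continuous[OF L] test_fn_continuous[OF \<phi>(1)]
      by (auto intro: borel_measurable_continuous_onI)
    have "integrable lborel (\<lambda>x. (L * \<nu>.first_moment) *\<^sub>R \<phi> x)"
      using test_fn_integrable[OF \<phi>(1)] by simp
    then have "integrable lborel (\<lambda>x. \<phi> x \<bullet> ?g x)"
    proof (rule Bochner_Integration.integrable_bound)
      have "\<bar>\<phi> x \<bullet> ?g x\<bar> \<le> norm ((L * \<nu>.first_moment) *\<^sub>R \<phi> x)" for x
      proof -
        have "\<bar>\<phi> x \<bullet> ?g x\<bar> \<le> norm (\<phi> x) * norm (?g x)" by (rule Cauchy_Schwarz_ineq2)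
        also have "\<dots> \<le> norm (\<phi> x) * \<bar>L * \<nu>.first_moment\<bar>"
          by (intro mult_left_mono order_trans[OF \<nu>.vgrad_bounded[OF L] abs_ge_self]) auto
        finally show ?thesis by (simp add: mult.commute)
      qed
      then show "AE x in lborel. norm (\<phi> x \<bullet> ?g x) \<le> norm ((L * \<nu>.first_moment) *\<^sub>R \<phi> x)" by simp
    qed measurable
    from integral_norm_bound_ennreal[OF this]
    have "ennreal \<bar>LINT x|lborel. \<phi> x \<bullet> ?g x\<bar> \<le> (\<integral>\<^sup>+x. ennreal (norm (\<phi> x \<bullet> ?g x)) \<partial>lborel)" by simp
    also have "\<dots> \<le> (\<integral>\<^sup>+x. ennreal (norm (?g x)) \<partial>lborel)"
    proof (intro nn_integral_mono ennreal_leI)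
      fix x
      have "norm (\<phi> x \<bullet> ?g x) \<le> norm (\<phi> x) * norm (?g x)"
        unfolding real_norm_def by (rule Cauchy_Schwarz_ineq2)
      also have "\<dots> \<le> 1 * norm (?g x)" by (intro mult_right_mono \<phi>) auto
      finally show "norm (\<phi> x \<bullet> ?g x) \<le> norm (?g x)" by simp
    qed
    finally have "enn2ereal (ennreal \<bar>LINT x|lborel. \<phi> x \<bullet> ?g x\<bar>) \<le> F t"
      unfolding F by (simp only: less_eq_ennreal.rep_eq)
    then have "ereal \<bar>LINT x|lborel. \<phi> x \<bullet> ?g x\<bar> \<le> F t"
      by (simp add: enn2ereal_ennreal)
    moreover have "ereal (J (t powr (1 / \<alpha>)) \<phi>) \<le> ereal \<bar>LINT x|lborel. \<phi> x \<bullet> ?g x\<bar>"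
      unfolding duality_f[OF t \<phi>(1), symmetric] by simp
    ultimately show ?thesis by (rule order_trans[rotated])
  qed

  have J_tendsto: "((\<lambda>t. J (t powr (1 / \<alpha>)) \<phi>) \<longlongrightarrow> (LINT x|lborel. indicator E x * vdiv \<nu> \<phi> x)) (at_right 0)"
    if \<phi>: "test_fn \<phi>" for \<phi>
  proof -
    obtain M where M: "bdd_lip M \<phi>" using test_fn_bdd_lip[OF \<phi>] .
    have lim: "((\<lambda>s. J s \<phi>) \<longlongrightarrow> (LINT x|lborel. indicator E x * vdiv \<nu> \<phi> x)) (at_right 0)"
      unfolding J_def
      by (rule integral_avg_tendsto[OF E fin \<nu>.vdiv_continuous[OF M] \<nu>.vdiv_bounded[OF M]])
    have "((\<lambda>t. t powr (1 / \<alpha>)) \<longlongrightarrow> 0 powr (1 / \<alpha>)) (at_right 0)"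
      by (rule tendsto_powr'[OF tendsto_ident_at tendsto_const])
         (use assms(1) in \<open>simp add: eventually_at_filter\<close>)
    then have "((\<lambda>t. t powr (1 / \<alpha>)) \<longlongrightarrow> 0) (at_right 0)" by simp
    then have "filterlim (\<lambda>t. t powr (1 / \<alpha>)) (at_right 0) (at_right 0)"
      by (rule tendsto_imp_filterlim_at_right) (auto simp: eventually_at_filter)
    from filterlim_compose[OF lim this] show ?thesis .
  qed

  \<comment> \<open>The order form of convergence treats finite and infinite \<open>V\<close> alike:
    a bound below \<open>V\<close> is exceeded by a single test field, whose \<open>J\<close>
    converges, and a bound above \<open>V\<close> is respected at every positive time.\<close>
  have "(F \<longlongrightarrow> V) (at_right 0)"
  proof (rule order_tendstoI)
    fix a assume "a < V"
    then obtain \<phi> where \<phi>: "\<phi> \<in> test_fields" "(SUP x. norm (\<phi> x)) \<le> 1"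
        "a < ereal (LINT x:E|lborel. frac_div \<nu> \<phi> x)"
      unfolding V_def frac_perimeter_var_def less_Sup_iff by auto
    then have \<phi>': "test_fn \<phi>" "\<And>x. norm (\<phi> x) \<le> 1"
      using SUP_norm_le_iff[of \<phi> 1] by (auto simp: test_fields_iff)
    obtain M where M: "bdd_lip M \<phi>" using test_fn_bdd_lip[OF \<phi>'(1)] .
    have "a < ereal (LINT x|lborel. indicator E x * vdiv \<nu> \<phi> x)"
      using \<phi>(3) by (simp add: set_lebesgue_integral_def frac_div_eq_vdiv[OF levy M])
    with tendsto_ereal[OF J_tendsto[OF \<phi>'(1)]]
    have "\<forall>\<^sub>F t in at_right 0. a < ereal (J (t powr (1 / \<alpha>)) \<phi>)"
      by (rule order_tendstoD)
    moreover have "\<forall>\<^sub>F t in at_right 0. ereal (J (t powr (1 / \<alpha>)) \<phi>) \<le> F t"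
      using F_ge[OF _ \<phi>'] by (auto simp: eventually_at_filter)
    ultimately show "\<forall>\<^sub>F t in at_right 0. a < F t"
      by eventually_elim (rule less_le_trans)
  next
    fix a assume "V < a"
    then show "\<forall>\<^sub>F t in at_right 0. F t < a"
      by (auto simp: eventually_at_filter intro!: always_eventually le_less_trans[OF F_le])
  qed
  then have "Lim (at_right 0) F = V"
    by (intro tendsto_Lim) auto
  then show ?thesis
    unfolding V_def F_def[abs_def] f_def \<nu>_def frac_perimeter_def by simp
qed

end
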